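(* Let $T\in\mathbb{P}(S^d\mathbb{C}^3)$ be a form of degree $d$ in three variables, let $A\subset\mathbb{P}^2$ be a non-redundant finite set which computes $T$, and put $r=\ell(A)$. Then $T$ is identifiable of rank $r$ if one of the following holds: (1) $d=2m$ is even, $k_{m-1}(A)=\min\{\binom{m+1}{2},r\}$, and $h_A(m)=r\le\binom{m+2}{2}-2$; (2) $d=2m+1$ is odd, $k_m(A)=\min\{\binom{m+2}{2},r\}$, and $h_A(m+1)=r\le\binom{m+2}{2}+\lfloor\frac m2\rfloor$.
   Context: Work over $\mathbb{C}$. $S^d\mathbb{C}^{3}$ is the space of forms of degree $d$ in $x_0,x_1,x_2$; a nonzero form $T$ is identified with its class in $\mathbb{P}(S^d\mathbb{C}^3)$. $\mathbb{P}^2$ denotes the projective space of linear forms in $x_0,x_1,x_2$, and $v_d:\mathbb{P}^2\to\mathbb{P}(S^d\mathbb{C}^3)$, $v_d([L])=[L^d]$, is the Veronese map. $\ell(A)$ denotes the cardinality of a finite set $A$, and $\langle\cdot\rangle$ denotes projective linear span. A finite set $A\subset\mathbb{P}^2$ computes $T$ if $T\in\langle v_d(A)\rangle$; it is non-redundant (for $T$) if no proper subset $A'\subsetneq A$ satisfies $T\in\langle v_d(A')\rangle$. The rank of $T$ is $\min\{\ell(A): T\in\langle v_d(A)\rangle\}$. A finite set computes the rank of $T$ if it computes $T$, is non-redundant, and has cardinality equal to the rank of $T$. $T$ is identifiable if there is a unique finite set computing the rank of $T$. Hilbert function: choose homogeneous coordinate vectors $Y_1,\dots,Y_\ell\in\mathbb{C}^3$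 for the points of $A$ (the point $[a_0x_0+a_1x_1+a_2x_2]$ has coordinates $(a_0,a_1,a_2)$). For $j\ge 0$, $h_A(j)$ is the rank of the evaluation map sending a form $F$ of degree $j$ in three variables to $(F(Y_1),\dots,F(Y_\ell))\in\mathbb{C}^{\ell}$; $h_A(j)=0$ for $j<0$. Kruskal rank: $k_j(A)$ is the largest integer $k\le\ell(A)$ such that for every subset $A'\subset A$ with $\ell(A')\le k$ the points $v_j(A')$ are linearly independent, i.e. $\dim\langle v_j(A')\rangle=\ell(A')-1$. *)

theory Defs
  imports
    "HOL-Analysis.Analysis"
    "HOL-Library.Poly_Mapping"
    "HOL-Library.Function_Algebras"
begin

text \<open>The polynomial ring in x_0, x_1, x_2 over the complex numbers: a monomial is an exponent vector
  indexed by the three-element type, and multiplication is convolution of coefficients.\<close>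

type_synonym monom3 = "3 \<Rightarrow>\<^sub>0 nat"
type_synonym poly3 = "monom3 \<Rightarrow>\<^sub>0 complex"

definition scale3 :: "complex \<Rightarrow> poly3 \<Rightarrow> poly3" where
  "scale3 c F = Poly_Mapping.single 0 c * F"

interpretation poly3: vector_space scale3
  by standard (simp_all add: scale3_def algebra_simps single_add mult_single flip: mult.assoc)

definition forms :: "nat \<Rightarrow> poly3 set" where
  "forms d = {F. \<forall>e \<in> Poly_Mapping.keys F. (\<Sum>i\<in>UNIV. Poly_Mapping.lookup e i) = d}"

definition eval3 :: "poly3 \<Rightarrow> complex ^ 3 \<Rightarrow> complex" where
  "eval3 F a = (\<Sum>e\<in>Poly_Mapping.keys F.
     Poly_Mapping.lookup F e * (\<Prod>i\<in>UNIV. (a $ i) ^ Poly_Mapping.lookup e i))"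

text \<open>A projective point is the line (one-dimensional linear subspace) spanned by a nonzero vector,
  so a point is itself a set of polynomials.\<close>

definition pclass :: "poly3 \<Rightarrow> poly3 set" where
  "pclass F = poly3.span {F}"

definition proj :: "poly3 set \<Rightarrow> poly3 set set" where
  "proj V = pclass ` (V - {0})"

abbreviation P2 :: "poly3 set set" where
  "P2 \<equiv> proj (forms 1)"

definition pspan :: "poly3 set set \<Rightarrow> poly3 set set" where
  "pspan X = proj (poly3.span (\<Union>X))"

text \<open>Projective dimension of the span; the empty set gives -1.\<close>

definition pspan_dim :: "poly3 set set \<Rightarrow> int" where
  "pspan_dim X = int (poly3.dim (poly3.span (\<Union>X))) - 1"

text \<open>A choice-free form of the map sending the class of L to the class of L^d;
  see \<open>veronese_pclass\<close>.\<close>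

definition veronese :: "nat \<Rightarrow> poly3 set \<Rightarrow> poly3 set" where
  "veronese d p = poly3.span {L ^ d | L. L \<in> p}"

lemma scale3_power: "scale3 c F ^ d = scale3 (c ^ d) (F ^ d)"
proof -
  have "Poly_Mapping.single 0 c ^ d = (Poly_Mapping.single 0 (c ^ d) :: poly3)"
    by (induction d) (simp_all add: mult_single)
  then show ?thesis by (simp add: scale3_def power_mult_distrib)
qed

lemma veronese_pclass: "veronese d (pclass L) = pclass (L ^ d)"
proof -
  have sub: "{M ^ d | M. M \<in> poly3.span {L}} \<subseteq> poly3.span {L ^ d}"
    by (auto simp: poly3.span_singleton scale3_power)
  have "L ^ d \<in> {M ^ d | M. M \<in> poly3.span {L}}"
    using poly3.span_base by blast
  with sub show ?thesis
    unfolding veronese_def pclass_def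
    by (intro antisym poly3.span_minimal poly3.subspace_span) (auto intro: poly3.span_base)
qed

definition computes :: "nat \<Rightarrow> poly3 set set \<Rightarrow> poly3 set \<Rightarrow> bool" where
  "computes d A T \<longleftrightarrow> finite A \<and> A \<subseteq> P2 \<and> T \<in> pspan (veronese d ` A)"

definition non_redundant :: "nat \<Rightarrow> poly3 set set \<Rightarrow> poly3 set \<Rightarrow> bool" where
  "non_redundant d A T \<longleftrightarrow> (\<forall>A'. A' \<subset> A \<longrightarrow> T \<notin> pspan (veronese d ` A'))"

definition form_rank :: "nat \<Rightarrow> poly3 set \<Rightarrow> nat" where
  "form_rank d T = (LEAST n. \<exists>A. computes d A T \<and> card A = n)"

definition computes_rank :: "nat \<Rightarrow> poly3 set set \<Rightarrow> poly3 set \<Rightarrow> bool" where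
  "computes_rank d A T \<longleftrightarrow>
     computes d A T \<and> non_redundant d A T \<and> card A = form_rank d T"

definition identifiable :: "nat \<Rightarrow> poly3 set \<Rightarrow> bool" where
  "identifiable d T \<longleftrightarrow> (\<exists>!A. computes_rank d A T)"

interpretation cfun: vector_space "\<lambda>(c::complex) (f::'a \<Rightarrow> complex) x. c * f x"
  by standard (simp_all add: fun_eq_iff algebra_simps)

text \<open>Coordinates of a point of the plane, read off from an arbitrary nonzero linear form on the
  line. Another choice rescales each coordinate of the evaluation map by a nonzero constant, so it
  does not affect the Hilbert function.\<close>

definition coords :: "poly3 set \<Rightarrow> complex ^ 3" where
  "coords p = (let L = (SOME L. L \<in> p \<and> L \<noteq> 0)
     in \<chi> i. Poly_Mapping.lookup L (Poly_Mapping.single i 1))"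

text \<open>Extending by 0 outside A embeds the evaluation target, complex vectors indexed by A, into functions.\<close>

definition eval_at :: "poly3 set set \<Rightarrow> poly3 \<Rightarrow> (poly3 set \<Rightarrow> complex)" where
  "eval_at A F = (\<lambda>p. if p \<in> A then eval3 F (coords p) else 0)"

definition hilb :: "poly3 set set \<Rightarrow> int \<Rightarrow> nat" where
  "hilb A j = (if j < 0 then 0 else cfun.dim (eval_at A ` forms (nat j)))"

text \<open>The dimension is compared with the cardinality of the subset itself, not of its image, so
  that for j = 0, where all points have the same image, two points count as dependent.\<close>

definition kruskal_rank :: "nat \<Rightarrow> poly3 set set \<Rightarrow> nat" where
  "kruskal_rank j A = Max {k. k \<le> card A \<and>
     (\<forall>A'. A' \<subseteq> A \<and> card A' \<le> k \<longrightarrow> pspan_dim (veronese j ` A') = int (card A') - 1)}"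

end

theory Submission
  imports
    Defs
    "HOL-Computational_Algebra.Polynomial_Factorial"
    "HOL-Computational_Algebra.Field_as_Ring"
    "HOL-Computational_Algebra.Fundamental_Theorem_Algebra"
begin

text \<open>Let X be the given set of r points and Y another one, of at most r points, computing T. By
  apolarity both decompositions express one functional on forms of degree d as weighted evaluations,
  so the weighted points of X and Y together annihilate all forms of degree d. Put n = m - 1 for even
  d and n = m for odd d, so that subsets of X of size at most N = binom(n + 2, 2) impose independent
  conditions in degree n.

  If r is at most N, then X is cut out in degree n + 1, and forms of degree d - n vanishing on Y vanish
  on X, which forces Y = X. Otherwise the numerical bound provides two linearly independent forms of
  degree n + 1 vanishing on X and Y. Removing their greatest common divisor Q leaves a complete
  intersection, which imposes independent conditions in degree d - deg Q; hence X and Y coincide off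
  the curve Q = 0. As Q has degree at most n, fewer than N points of X lie on it, and the first
  case applies to the points on the curve.\<close>

section \<open>Ternary forms as functions and conditions imposed by points\<close>

text \<open>The numerical bounds are exactly what leaves two independent forms of degree n + 1.
  Vanishing is imposed on Y and on a part S of X whose complement imposes independent conditions in
  degree d - n - 1; the relation between the weights then forces vanishing on the rest of X. Two
  forms survive if r + |S| + 2 is at most binom(n + 3, 2). For even d the Hilbert function permits S
  to be empty, hence r <= binom(m + 2, 2) - 2. For odd d one has d - n - 1 = n = m, so S consists of
  the points beyond a subset of size binom(m + 2, 2) covered by the Kruskal rank. As binom(m + 3, 2)
  exceeds binom(m + 2, 2) by m + 2, the requirement reads 2r <= 2 binom(m + 2, 2) + m, which is the
  origin of floor(m/2). One form would not suffice: its curve has degree n + 1, whereas the Kruskal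
  rank limits the points of X only on curves of degree n. The two forms may meet with multiplicities
  and outside X and Y, so intersection points are never counted; instead of a theorem of Bezout or
  Cayley-Bacharach type, the weights themselves are shown to vanish.\<close>

lemma homogeneous_system_nontrivial_solution:
  fixes M :: "'j \<Rightarrow> 'i \<Rightarrow> complex"
  assumes "finite J" and "finite I" and "card J < card I"
  shows "\<exists>t. (\<exists>i\<in>I. t i \<noteq> 0) \<and> (\<forall>j\<in>J. (\<Sum>i\<in>I. M j i * t i) = 0)"
  using assms
proof (induction J arbitrary: I M rule: finite_induct)
  case empty
  then have "I \<noteq> {}" by auto
  then show ?case by (intro exI[of _ "\<lambda>_. 1"]) auto
next
  case (insert j J)
  show ?case
  proof (cases "\<forall>i\<in>I. M j i = 0")
    case True
    with insert.IH[of I M] insert.prems insert.hyps show ?thesis by auto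
  next
    case False
    then obtain k where k: "k \<in> I" "M j k \<noteq> 0" by auto
    let ?I = "I - {k}"
    \<comment> \<open>Row reduction with pivot \<open>M j k\<close>; equation \<open>j\<close> is
      then solved for the unknown \<open>k\<close>.\<close>
    let ?M = "\<lambda>j' i. M j' i - M j' k * M j i / M j k"
    have "card J < card ?I" using insert.prems insert.hyps k by auto
    with insert.IH[of ?I ?M] insert.prems obtain t where
      t: "\<exists>i\<in>?I. t i \<noteq> 0" "\<forall>j'\<in>J. (\<Sum>i\<in>?I. ?M j' i * t i) = 0" by auto
    define s where "s = (\<Sum>i\<in>?I. M j i * t i)"
    define t' where "t' = t(k := - s / M j k)"
    have split: "(\<Sum>i\<in>I. M j' i * t' i) = M j' k * t' k + (\<Sum>i\<in>?I. M j' i * t i)" for j'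
      using sum.remove[OF \<open>finite I\<close> k(1), of "\<lambda>i. M j' i * t' i"] by (auto simp: t'_def intro!: sum.cong)
    have "(\<Sum>i\<in>I. M j i * t' i) = 0" unfolding split s_def[symmetric] using k by (simp add: t'_def)
    moreover have "(\<Sum>i\<in>I. M j' i * t' i) = 0" if "j' \<in> J" for j'
    proof -
      have "(\<Sum>i\<in>?I. ?M j' i * t i) = (\<Sum>i\<in>?I. M j' i * t i) - M j' k / M j k * s"
        by (simp add: s_def sum_distrib_left sum_subtractf algebra_simps)
      then have "(\<Sum>i\<in>?I. M j' i * t i) = M j' k / M j k * s" using t(2) that by simp
      then show ?thesis unfolding split by (simp add: t'_def)
    qed
    moreover have "\<exists>i\<in>I. t' i \<noteq> 0" using t(1) by (auto simp: t'_def)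
    ultimately show ?thesis by blast
  qed
qed

definition tri :: "nat \<Rightarrow> (nat \<times> nat) set" where
  "tri t = (SIGMA i:{..t}. {..t - i})"

lemma tri_iff [simp]: "(i, j) \<in> tri t \<longleftrightarrow> i + j \<le> t"
  by (auto simp: tri_def)

lemma finite_tri [simp]: "finite (tri t)"
  by (simp add: tri_def)

lemma card_tri: "card (tri t) = (t + 2) choose 2"
proof -
  have "card (tri t) = (\<Sum>i\<le>t. Suc (t - i))" by (simp add: tri_def)
  also have "\<dots> = (\<Sum>i\<le>t. Suc i)"
    by (rule sum.reindex_bij_witness[of _ "\<lambda>i. t - i" "\<lambda>i. t - i"]) auto
  also have "\<dots> = (t + 2) choose 2"
    by (induction t) (simp_all add: numeral_2_eq_2)
  finally show ?thesis .
qed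

text \<open>The subtraction is truncated: only for \<open>e\<close> in \<open>tri t\<close> is this
  a monomial of degree \<open>t\<close>.\<close>

definition tmono :: "nat \<Rightarrow> nat \<times> nat \<Rightarrow> complex ^ 3 \<Rightarrow> complex" where
  "tmono t e p = p $ 1 ^ fst e * p $ 2 ^ snd e * p $ 3 ^ (t - fst e - snd e)"

text \<open>Forms are kept as functions. Over an infinite field nothing is lost, and evaluation and
  products need no polynomial arithmetic.\<close>

definition hforms :: "nat \<Rightarrow> (complex ^ 3 \<Rightarrow> complex) set" where
  "hforms t = {F. \<exists>c. F = (\<lambda>p. \<Sum>e\<in>tri t. c e * tmono t e p)}"

lemma hforms_expand:
  assumes "F \<in> hforms t"
  shows "\<exists>c. \<forall>p. F p = (\<Sum>e\<in>tri t. c e * tmono t e p)"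
  using assms by (auto simp: hforms_def)

lemma hforms_zero: "(\<lambda>p. 0) \<in> hforms t"
  by (auto simp: hforms_def intro!: exI[of _ "\<lambda>_. 0"])

lemma hforms_add:
  assumes "F \<in> hforms t" "G \<in> hforms t"
  shows "(\<lambda>p. F p + G p) \<in> hforms t"
proof -
  obtain c c' where "F = (\<lambda>p. \<Sum>e\<in>tri t. c e * tmono t e p)" "G = (\<lambda>p. \<Sum>e\<in>tri t. c' e * tmono t e p)"
    using assms by (auto simp: hforms_def)
  then show ?thesis
    by (auto simp: hforms_def sum.distrib ring_distribs intro!: exI[of _ "\<lambda>e. c e + c' e"])
qed

lemma hforms_scale:
  assumes "F \<in> hforms t"
  shows "(\<lambda>p. a * F p) \<in> hforms t"
proof -
  obtain c where "F = (\<lambda>p. \<Sum>e\<in>tri t. c e * tmono t e p)" using assms by (auto simp: hforms_def)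
  then show ?thesis
    by (auto simp: hforms_def sum_distrib_left mult.assoc intro!: exI[of _ "\<lambda>e. a * c e"])
qed

lemma hforms_diff:
  assumes "F \<in> hforms t" "G \<in> hforms t"
  shows "(\<lambda>p. F p - G p) \<in> hforms t"
  using hforms_add[OF assms(1) hforms_scale[OF assms(2), of "-1"]] by simp

lemma hforms_sum:
  assumes "\<And>i. i \<in> I \<Longrightarrow> F i \<in> hforms t"
  shows "(\<lambda>p. \<Sum>i\<in>I. F i p) \<in> hforms t"
proof (cases "finite I")
  case True
  then show ?thesis using assms
    by (induction I rule: finite_induct) (auto intro: hforms_zero hforms_add)
qed (simp add: hforms_zero)

lemma hforms_tmono: 
  assumes "e \<in> tri t"
  shows "tmono t e \<in> hforms t"
proof -
  have "tmono t e = (\<lambda>p. \<Sum>e'\<in>tri t. (if e' = e then 1 else 0) * tmono t e' p)"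
    using assms by (simp add: if_distrib[of "\<lambda>x. x * _"] cong: if_cong)
  then show ?thesis unfolding hforms_def by (intro CollectI exI)
qed

lemma hforms_mult:
  assumes "F \<in> hforms s" "G \<in> hforms t"
  shows "(\<lambda>p. F p * G p) \<in> hforms (s + t)"
proof -
  obtain c where c: "\<And>p. F p = (\<Sum>e\<in>tri s. c e * tmono s e p)"
    using hforms_expand[OF assms(1)] by blast
  obtain c' where c': "\<And>p. G p = (\<Sum>e\<in>tri t. c' e * tmono t e p)"
    using hforms_expand[OF assms(2)] by blast
  have m: "tmono s e p * tmono t e' p = tmono (s + t) (fst e + fst e', snd e + snd e') p"
    if "e \<in> tri s" "e' \<in> tri t" for e e' p
  proof -
    have "s + t - (fst e + fst e') - (snd e + snd e') = (s - fst e - snd e) + (t - fst e' - snd e')"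
      using that by (cases e; cases e') auto
    then show ?thesis by (simp add: tmono_def power_add mult_ac)
  qed
  have "(\<lambda>p. F p * G p) = (\<lambda>p. \<Sum>e\<in>tri s. \<Sum>e'\<in>tri t. c e * c' e' * tmono (s + t) (fst e + fst e', snd e + snd e') p)"
    by (rule ext, unfold c c' sum_product, intro sum.cong refl) (simp add: m[symmetric] mult_ac)
  also have "\<dots> \<in> hforms (s + t)"
    by (intro hforms_sum hforms_scale hforms_tmono) auto
  finally show ?thesis .
qed

lemma hforms_const: "(\<lambda>p. a) \<in> hforms 0"
proof -
  have "tri 0 = {(0,0)}" by auto
  then show ?thesis by (auto simp: hforms_def tmono_def intro!: exI[of _ "\<lambda>_. a"])
qed

lemma hforms_power:
  assumes "F \<in> hforms s"
  shows "(\<lambda>p. F p ^ n) \<in> hforms (n * s)"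
proof (induction n)
  case (Suc n)
  then show ?case using hforms_mult[OF assms Suc] by simp
qed (use hforms_const[of 1] in simp)

lemma hforms_coord: "(\<lambda>p. p $ i) \<in> hforms 1"
proof -
  have "tmono 1 (1,0) \<in> hforms 1" "tmono 1 (0,1) \<in> hforms 1" "tmono 1 (0,0) \<in> hforms 1"
    by (auto intro!: hforms_tmono)
  then have "(\<lambda>p. p $ 1) \<in> hforms 1" "(\<lambda>p. p $ 2) \<in> hforms 1" "(\<lambda>p. p $ 3) \<in> hforms 1"
    by (simp_all add: tmono_def[abs_def])
  then show ?thesis using exhaust_3[of i] by auto
qed

lemma hforms_homogeneous:
  assumes "F \<in> hforms t"
  shows "F (a *s p) = a ^ t * F p"
proof -
  obtain c where c: "\<And>p. F p = (\<Sum>e\<in>tri t. c e * tmono t e p)" using hforms_expand[OF assms] by blast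
  have "tmono t e (a *s p) = a ^ t * tmono t e p" if "e \<in> tri t" for e
  proof -
    have "a ^ t = a ^ (fst e + snd e + (t - fst e - snd e))" using that by (cases e) auto
    then show ?thesis by (simp add: tmono_def power_add power_mult_distrib mult_ac)
  qed
  then show ?thesis by (auto simp: c sum_distrib_left mult_ac intro!: sum.cong)
qed

text \<open>There are more monomials than conditions. The witness \<open>v\<close> is normalised to
  last coordinate 1 because it later becomes the point at infinity of a chart that requires
  this.\<close>

lemma hforms_exists_vanishing:
  assumes "finite X" and "card X < card (tri k)"
  obtains F v where "F \<in> hforms k" "\<And>x. x \<in> X \<Longrightarrow> F x = 0" "v $ 3 = 1" "F v \<noteq> 0"
proof -
  obtain c e\<^sub>0 where e0: "e\<^sub>0 \<in> tri k" "c e\<^sub>0 \<noteq> 0" and c: "\<And>x. x \<in> X \<Longrightarrow> (\<Sum>e\<in>tri k. tmono k e x * c e) = 0"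
    using homogeneous_system_nontrivial_solution[OF assms(1) finite_tri assms(2), of "\<lambda>x e. tmono k e x"] by auto
  define F where "F = (\<lambda>p. \<Sum>e\<in>tri k. c e * tmono k e p)"
  \<comment> \<open>Kronecker substitution: the monomials of degree k become distinct powers of s.\<close>
  define P where "P = (\<Sum>e\<in>tri k. monom (c e) (fst e + Suc k * snd e))"
  have inj: "e = e\<^sub>0" if "e \<in> tri k" "fst e + Suc k * snd e = fst e\<^sub>0 + Suc k * snd e\<^sub>0" for e
  proof -
    have "fst e < Suc k" "fst e\<^sub>0 < Suc k" using that e0 by (cases e; cases e\<^sub>0; auto)+
    then have "(fst e' + Suc k * snd e') mod Suc k = fst e'" "(fst e' + Suc k * snd e') div Suc k = snd e'"
      if "e' \<in> {e, e\<^sub>0}" for e'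
      using that by (auto simp only: mod_mult_self2 mod_less div_mult_self2 div_less)
    then have "fst e = fst e\<^sub>0" "snd e = snd e\<^sub>0" using that(2) by (metis insertCI)+
    then show ?thesis by (simp add: prod_eq_iff)
  qed
  have "coeff P (fst e\<^sub>0 + Suc k * snd e\<^sub>0) = (\<Sum>e\<in>tri k. if e = e\<^sub>0 then c e else 0)"
    unfolding P_def coeff_sum coeff_monom using inj by (intro sum.cong) auto
  also have "\<dots> = c e\<^sub>0" using e0 by simp
  finally have "P \<noteq> 0" using e0 by auto
  then obtain s where s: "poly P s \<noteq> 0" using poly_all_0_iff_0 by blast
  define v :: "complex ^ 3" where "v = vector [s, s ^ Suc k, 1]"
  have v: "v $ 1 = s" "v $ 2 = s ^ Suc k" "v $ 3 = 1" by (simp_all add: v_def)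
  have "F v = poly P s"
    unfolding F_def P_def poly_sum poly_monom tmono_def v
    by (intro sum.cong) (simp_all only: power_one power_add power_mult mult_1_right)
  moreover have "F \<in> hforms k" by (auto simp: F_def hforms_def)
  moreover have "F x = 0" if "x \<in> X" for x using c[OF that] by (simp add: F_def mult.commute)
  ultimately show ?thesis using that s v by metis
qed

text \<open>Stated dually, by relations among evaluation functionals, because relations are what two
  decompositions of one form provide. Surjectivity of evaluation is recovered in
  \<open>indep_pts_separators\<close>.\<close>

definition indep_pts :: "nat \<Rightarrow> (complex ^ 3) set \<Rightarrow> bool" where
  "indep_pts n X \<longleftrightarrow> (\<forall>c. (\<forall>F\<in>hforms n. (\<Sum>x\<in>X. c x * F x) = 0) \<longrightarrow> (\<forall>x\<in>X. c x = 0))"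

lemma indep_ptsD:
  assumes "indep_pts n X" "\<And>F. F \<in> hforms n \<Longrightarrow> (\<Sum>x\<in>X. c x * F x) = 0" "x \<in> X"
  shows "c x = 0"
  using assms unfolding indep_pts_def by blast

text \<open>With \<open>v\<close> added there are more points than monomials, hence a nontrivial
  relation. Testing it on \<open>Q\<close> kills the weight of \<open>v\<close>, and independence of
  \<open>X\<close> kills the others.\<close>

lemma indep_pts_no_vanishing:
  assumes "finite X" "indep_pts n X" "card (tri n) \<le> card X" "Q \<in> hforms n" "\<And>x. x \<in> X \<Longrightarrow> Q x = 0"
  shows "Q v = 0"
proof (rule ccontr)
  assume "Q v \<noteq> 0"
  with assms have v: "v \<notin> X" by auto
  with assms have "card (tri n) < card (insert v X)" by simp
  from homogeneous_system_nontrivial_solution[OF finite_tri _ this, of "tmono n"] assms obtain w where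
    w: "\<exists>x\<in>insert v X. w x \<noteq> 0" "\<And>e. e \<in> tri n \<Longrightarrow> (\<Sum>x\<in>insert v X. tmono n e x * w x) = 0" by auto
  have kill: "(\<Sum>x\<in>insert v X. w x * F x) = 0" if "F \<in> hforms n" for F
  proof -
    obtain c where c: "\<And>p. F p = (\<Sum>e\<in>tri n. c e * tmono n e p)" using hforms_expand[OF \<open>F \<in> hforms n\<close>] by blast
    have "(\<Sum>x\<in>insert v X. w x * F x) = (\<Sum>x\<in>insert v X. \<Sum>e\<in>tri n. c e * (tmono n e x * w x))"
      by (simp only: c sum_distrib_left mult_ac)
    also have "\<dots> = (\<Sum>e\<in>tri n. c e * (\<Sum>x\<in>insert v X. tmono n e x * w x))"
      by (subst sum.swap) (simp only: sum_distrib_left)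
    finally show ?thesis using w(2) by simp
  qed
  from kill[OF assms(4)] v assms(1,5) have wv: "w v = 0" using \<open>Q v \<noteq> 0\<close> by simp
  have "w x = 0" if "x \<in> X" for x
    by (rule indep_ptsD[OF assms(2) _ that]) (use kill wv v assms(1) in simp)
  with w(1) wv show False by auto
qed

text \<open>A dual basis is built point by point. \<open>R F\<close> is what remains of
  \<open>F\<close> after interpolation on the old points; if it always vanished at the new point
  \<open>z\<close>, evaluation at \<open>z\<close> would be a combination of the old evaluations,
  contrary to independence.\<close>

lemma indep_pts_separators:
  assumes "finite X" "indep_pts n X" "x \<in> X"
  obtains F where "F \<in> hforms n" "F x = 1" "\<And>y. y \<in> X - {x} \<Longrightarrow> F y = 0"
proof -
  have "\<forall>x\<in>X. \<exists>F\<in>hforms n. F x = 1 \<and> (\<forall>y\<in>X-{x}. F y = 0)"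
    using assms(1,2)
  proof (induction X rule: finite_induct)
    case (insert z X)
    have "indep_pts n X"
      unfolding indep_pts_def
    proof (intro allI impI)
      fix c assume c: "\<forall>F\<in>hforms n. (\<Sum>x\<in>X. c x * F x) = 0"
      have "(c(z := 0)) x = 0" if "x \<in> insert z X" for x
      proof (rule indep_ptsD[OF insert.prems _ that])
        fix F assume F: "F \<in> hforms n"
        have "(\<Sum>x\<in>X. (c(z := 0)) x * F x) = (\<Sum>x\<in>X. c x * F x)"
          by (rule sum.cong) (use insert.hyps in auto)
        then show "(\<Sum>x\<in>insert z X. (c(z := 0)) x * F x) = 0"
          using c F insert.hyps by (subst sum.insert) auto
      qed
      with insert.hyps show "\<forall>x\<in>X. c x = 0" by (metis fun_upd_apply insertI2)
    qed
    with insert.IH obtain E where E: "\<And>x. x \<in> X \<Longrightarrow> E x \<in> hforms n" 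
      "\<And>x y. x \<in> X \<Longrightarrow> y \<in> X \<Longrightarrow> E x y = (if y = x then 1 else 0)"
      by (metis DiffI singletonD)
    define R where "R F = (\<lambda>p. F p - (\<Sum>x\<in>X. F x * E x p))" for F
    have R: "R F \<in> hforms n" "\<And>y. y \<in> X \<Longrightarrow> R F y = 0" if "F \<in> hforms n" for F
    proof -
      show "R F \<in> hforms n" unfolding R_def using E(1) that
        by (intro hforms_diff hforms_sum hforms_scale) auto
      show "R F y = 0" if "y \<in> X" for y
        using that insert.hyps by (simp add: R_def E(2) if_distrib[of "\<lambda>x. _ * x"] cong: if_cong)
    qed
    have "\<exists>F\<in>hforms n. R F z \<noteq> 0"
    proof (rule ccontr)
      assume "\<not> ?thesis"
      then have *: "F z - (\<Sum>x\<in>X. F x * E x z) = 0" if "F \<in> hforms n" for F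
        using that by (auto simp: R_def)
      define c where "c x = (if x = z then 1 else - E x z)" for x
      have "c z = 0"
      proof (rule indep_ptsD[OF insert.prems])
        fix F assume F: "F \<in> hforms n"
        have "(\<Sum>x\<in>X. c x * F x) = - (\<Sum>x\<in>X. F x * E x z)"
          unfolding sum_negf[symmetric] by (rule sum.cong) (use insert.hyps in \<open>auto simp: c_def\<close>)
        then show "(\<Sum>x\<in>insert z X. c x * F x) = 0"
          using *[OF F] insert.hyps by (simp add: c_def)
      qed simp
      then show False by (simp add: c_def)
    qed
    then obtain F where F: "F \<in> hforms n" "R F z \<noteq> 0" by blast
    define G where "G = (\<lambda>p. inverse (R F z) * R F p)"
    have G: "G \<in> hforms n" "G z = 1" "\<And>y. y \<in> X \<Longrightarrow> G y = 0"
      using F R[OF F(1)] by (auto simp: G_def intro!: hforms_scale)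
    show ?case
    proof
      fix x assume x: "x \<in> insert z X"
      show "\<exists>F\<in>hforms n. F x = 1 \<and> (\<forall>y\<in>insert z X - {x}. F y = 0)"
      proof (cases "x = z")
        case True
        with G show ?thesis by blast
      next
        case False
        with x have "x \<in> X" by simp
        let ?E = "\<lambda>p. E x p - E x z * G p"
        have "?E \<in> hforms n" by (intro hforms_diff hforms_scale E(1) G(1) \<open>x \<in> X\<close>)
        moreover have "?E x = 1" "\<forall>y\<in>insert z X - {x}. ?E y = 0"
          using \<open>x \<in> X\<close> E(2) G by (auto split: if_splits)
        ultimately show ?thesis by (intro bexI[of _ ?E] conjI)
      qed
    qed
  qed simp
  with assms(3) that show ?thesis by blast
qed

section \<open>Bivariate polynomials of bounded total degree\<close>

text \<open>Elements of the type complex poly poly are read as polynomials in y over the polynomials in x.\<close>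

definition degbound :: "nat \<Rightarrow> complex poly poly set" where
  "degbound t = {f. \<forall>i. coeff f i \<noteq> 0 \<longrightarrow> degree (coeff f i) + i \<le> t}"

lemma degboundI: "(\<And>i. coeff f i \<noteq> 0 \<Longrightarrow> degree (coeff f i) + i \<le> t) \<Longrightarrow> f \<in> degbound t"
  by (simp add: degbound_def)

lemma degboundD: "f \<in> degbound t \<Longrightarrow> coeff f i \<noteq> 0 \<Longrightarrow> degree (coeff f i) + i \<le> t"
  by (simp add: degbound_def)

lemma degbound_mono: "f \<in> degbound s \<Longrightarrow> s \<le> t \<Longrightarrow> f \<in> degbound t"
  by (fastforce simp: degbound_def)

lemma degbound_degree: "f \<in> degbound t \<Longrightarrow> degree f \<le> t"
  by (cases "f = 0") (use degboundD[of f t "degree f"] in auto)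

lemma degbound_coeff_coeff: "f \<in> degbound t \<Longrightarrow> t < i + j \<Longrightarrow> coeff (coeff f i) j = 0"
  by (cases "coeff f i = 0") (use degboundD[of f t i] coeff_eq_0[of "coeff f i" j] in auto)

lemma degbound_0 [simp]: "0 \<in> degbound t"
  by (simp add: degbound_def)

lemma degbound_add: "f \<in> degbound t \<Longrightarrow> g \<in> degbound t \<Longrightarrow> f + g \<in> degbound t"
proof (rule degboundI)
  fix i assume *: "f \<in> degbound t" "g \<in> degbound t" "coeff (f + g) i \<noteq> 0"
  then have "i \<le> t" by (metis add_0 add_leE coeff_add degboundD)
  moreover have "degree (coeff p i) \<le> t - i" if "p \<in> degbound t" for p
    using degboundD[OF that, of i] by (cases "coeff p i = 0") auto
  note this[OF *(1)] this[OF *(2)]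
  ultimately show "degree (coeff (f + g) i) + i \<le> t"
    using degree_add_le[of "coeff f i" "t - i" "coeff g i"] by simp
qed

lemma degbound_uminus: "f \<in> degbound t \<Longrightarrow> - f \<in> degbound t"
  by (simp add: degbound_def)

lemma degbound_diff: "f \<in> degbound t \<Longrightarrow> g \<in> degbound t \<Longrightarrow> f - g \<in> degbound t"
  using degbound_add[of f t "- g"] by (simp add: degbound_uminus)

lemma degbound_sum: "(\<And>i. i \<in> I \<Longrightarrow> f i \<in> degbound t) \<Longrightarrow> (\<Sum>i\<in>I. f i) \<in> degbound t"
  by (induction I rule: infinite_finite_induct) (auto intro: degbound_add)

lemma degbound_mult:
  assumes "f \<in> degbound s" "g \<in> degbound t"
  shows "f * g \<in> degbound (s + t)"
proof (rule degboundI)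
  fix n assume nz: "coeff (f * g) n \<noteq> 0"
  have *: "degree (coeff f i * coeff g (n - i)) + n \<le> s + t" if "i \<le> n" "coeff f i * coeff g (n - i) \<noteq> 0" for i
    using degboundD[OF assms(1), of i] degboundD[OF assms(2), of "n - i"] that
      degree_mult_le[of "coeff f i" "coeff g (n - i)"] by fastforce
  \<comment> \<open>Some summand is nonzero, so \<open>n\<close> is at most \<open>s + t\<close> and
    the truncated difference \<open>s + t - n\<close> below is exact.\<close>
  have "\<exists>i\<le>n. coeff f i * coeff g (n - i) \<noteq> 0"
    using nz unfolding coeff_mult by (meson atMost_iff sum.not_neutral_contains_not_neutral)
  then have n: "n \<le> s + t" using * by (meson add_leE)
  have "degree (coeff (f * g) n) \<le> s + t - n"
    unfolding coeff_mult
  proof (rule degree_sum_le)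
    fix i assume "i \<in> {..n}"
    then show "degree (coeff f i * coeff g (n - i)) \<le> s + t - n"
      using *[of i] by (cases "coeff f i * coeff g (n - i) = 0") auto
  qed simp
  with n show "degree (coeff (f * g) n) + n \<le> s + t" by simp
qed

lemma degbound_exists: "\<exists>t. f \<in> degbound t"
proof (intro exI degboundI)
  fix i assume "coeff f i \<noteq> 0"
  then have "i \<le> degree f" by (rule le_degree)
  then have "degree (coeff f i) \<le> (\<Sum>i\<le>degree f. degree (coeff f i))"
    by (intro member_le_sum) auto
  with \<open>i \<le> degree f\<close> show "degree (coeff f i) + i \<le> (\<Sum>i\<le>degree f. degree (coeff f i)) + degree f" by simp
qed

text \<open>The product of the top-degree parts does not vanish.\<close>

lemma degbound_multD:
  assumes "f * g \<in> degbound t" "f \<noteq> 0" "g \<noteq> 0"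
  shows "\<exists>a b. f \<in> degbound a \<and> g \<in> degbound b \<and> a + b \<le> t"
proof -
  \<comment> \<open>Among the coefficients attaining the total degree, the one with the highest
    power of y is selected: the leading monomial for a graded order.\<close>
  have max: "\<exists>a i. f \<in> degbound a \<and> coeff f i \<noteq> 0 \<and> degree (coeff f i) + i = a \<and>
    (\<forall>i'>i. coeff f i' \<noteq> 0 \<longrightarrow> degree (coeff f i') + i' < a)" if "f \<noteq> 0" for f :: "complex poly poly"
  proof -
    define D where "D i = degree (coeff f i) + i" for i
    define S where "S = {i. coeff f i \<noteq> 0}"
    have S: "finite S" "S \<noteq> {}"
      using that MOST_coeff_eq_0[of f] leading_coeff_0_iff[of f]
      unfolding S_def by (simp add: MOST_iff_cofinite, blast)
    define a where "a = Max (D ` S)"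
    have le: "D i \<le> a" if "i \<in> S" for i using S that by (simp add: a_def)
    define M where "M = {i\<in>S. D i = a}"
    have "a \<in> D ` S" unfolding a_def using S by (intro Max_in) auto
    then have M: "finite M" "M \<noteq> {}" using S by (auto simp: M_def)
    have "Max M \<in> M" using M by (rule Max_in)
    moreover have "D i' < a" if "i' > Max M" "i' \<in> S" for i'
    proof -
      have "i' \<notin> M" using that M by (metis Max_ge leD)
      then show ?thesis using that le[of i'] by (auto simp: M_def)
    qed
    moreover have "f \<in> degbound a" using le by (intro degboundI) (auto simp: D_def S_def)
    ultimately show ?thesis by (intro exI[of _ a] exI[of _ "Max M"]) (auto simp: M_def D_def S_def)
  qed
  obtain a i where f: "f \<in> degbound a" "coeff f i \<noteq> 0" "degree (coeff f i) + i = a"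
    "\<And>i'. i' > i \<Longrightarrow> coeff f i' \<noteq> 0 \<Longrightarrow> degree (coeff f i') + i' < a"
    using max[OF assms(2)] by blast
  obtain b j where g: "g \<in> degbound b" "coeff g j \<noteq> 0" "degree (coeff g j) + j = b"
    "\<And>j'. j' > j \<Longrightarrow> coeff g j' \<noteq> 0 \<Longrightarrow> degree (coeff g j') + j' < b"
    using max[OF assms(3)] by blast
  \<comment> \<open>The coefficient at the product of the two leading monomials receives a single
    contribution, as every other pair of coefficients has too small a degree in x.\<close>
  let ?m = "degree (coeff f i) + degree (coeff g j)"
  have "coeff (coeff (f * g) (i + j)) ?m = (\<Sum>k\<le>i+j. coeff (coeff f k * coeff g (i + j - k)) ?m)"
    by (simp add: coeff_mult coeff_sum)
  also have "\<dots> = (\<Sum>k\<le>i+j. if k = i then coeff (coeff f i * coeff g j) ?m else 0)"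
  proof (intro sum.cong refl)
    fix k assume k: "k \<in> {..i+j}"
    have "coeff (coeff f k * coeff g (i + j - k)) ?m = 0" if "k \<noteq> i"
    proof (cases "coeff f k = 0 \<or> coeff g (i + j - k) = 0")
      case False
      have "degree (coeff f k) + k \<le> a" "degree (coeff g (i + j - k)) + (i + j - k) \<le> b"
        using False degboundD[OF f(1)] degboundD[OF g(1)] by auto
      moreover have "degree (coeff f k) + k < a \<or> degree (coeff g (i + j - k)) + (i + j - k) < b"
        using False f(4)[of k] g(4)[of "i + j - k"] that k by (cases "k < i") auto
      ultimately have "degree (coeff f k) + degree (coeff g (i + j - k)) < ?m"
        using f(3) g(3) k by auto
      then show ?thesis using degree_mult_le[of "coeff f k" "coeff g (i + j - k)"] 
        by (intro coeff_eq_0) simp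
    qed auto
    then show "coeff (coeff f k * coeff g (i + j - k)) ?m = (if k = i then coeff (coeff f i * coeff g j) ?m else 0)"
      by auto
  qed
  also have "\<dots> = coeff (coeff f i * coeff g j) ?m" by simp
  also have "\<dots> = lead_coeff (coeff f i) * lead_coeff (coeff g j)" by (rule coeff_mult_degree_sum)
  also have "\<dots> \<noteq> 0" using f(2) g(2) by simp
  finally have "\<not> t < i + j + ?m" using degbound_coeff_coeff[OF assms(1), of "i + j" ?m] by auto
  with f(1,3) g(1,3) show ?thesis by (intro exI[of _ a] exI[of _ b]) auto
qed

section \<open>Evaluation of bivariate polynomials and elimination of y\<close>

definition poly2 :: "complex poly poly \<Rightarrow> complex \<Rightarrow> complex \<Rightarrow> complex" where
  "poly2 f x y = poly (poly f [:y:]) x"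

lemma poly2_simps [simp]:
  "poly2 (f + g) x y = poly2 f x y + poly2 g x y"
  "poly2 (f - g) x y = poly2 f x y - poly2 g x y"
  "poly2 (f * g) x y = poly2 f x y * poly2 g x y"
  "poly2 (f ^ n) x y = poly2 f x y ^ n"
  "poly2 0 x y = 0"
  "poly2 1 x y = 1"
  "poly2 [:h:] x y = poly h x"
  "poly2 (pCons h f) x y = poly h x + y * poly2 f x y"
  "poly2 (smult h f) x y = poly h x * poly2 f x y"
  by (simp_all add: poly2_def)

lemma poly2_sum: "poly2 (\<Sum>i\<in>I. f i) x y = (\<Sum>i\<in>I. poly2 (f i) x y)"
  by (simp add: poly2_def poly_sum)

lemma poly2_nonzero:
  assumes "f \<noteq> 0"
  obtains x y where "poly2 f x y \<noteq> 0"
proof -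
  have "finite {h. poly f h = 0}" using assms by (rule poly_roots_finite)
  moreover have "infinite (range (\<lambda>y::complex. [:y:]))"
    using finite_imageD[of "\<lambda>y::complex. [:y:]" UNIV] infinite_UNIV_char_0[where 'a = complex]
    by (auto simp: inj_def)
  ultimately obtain y where "poly f [:y:] \<noteq> 0"
    by (metis (mono_tags, lifting) finite_subset image_subsetI mem_Collect_eq)
  then obtain x where "poly (poly f [:y:]) x \<noteq> 0" using poly_all_0_iff_0 by blast
  then show ?thesis using that by (simp add: poly2_def)
qed

lemma poly2_expand:
  assumes "f \<in> degbound t"
  shows "poly2 f x y = (\<Sum>(i, j)\<in>tri t. coeff (coeff f j) i * x ^ i * y ^ j)"
proof -
  have "poly2 f x y = (\<Sum>j\<le>t. poly (coeff f j) x * y ^ j)"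
  proof -
    have "poly f [:y:] = (\<Sum>j\<le>t. coeff f j * [:y:] ^ j)"
      using degbound_degree[OF assms] 
      by (subst poly_altdef, intro sum.mono_neutral_left) (auto simp: coeff_eq_0)
    then show ?thesis by (simp add: poly2_def poly_sum)
  qed
  also have "\<dots> = (\<Sum>j\<le>t. \<Sum>i\<le>t-j. coeff (coeff f j) i * x ^ i * y ^ j)"
  proof (intro sum.cong refl)
    fix j assume "j \<in> {..t}"
    have "poly (coeff f j) x = (\<Sum>i\<le>t-j. coeff (coeff f j) i * x ^ i)"
    proof (cases "coeff f j = 0")
      case False
      with degboundD[OF assms this] show ?thesis 
        by (subst poly_altdef, intro sum.mono_neutral_left) (auto simp: coeff_eq_0)
    qed simp
    then show "poly (coeff f j) x * y ^ j = (\<Sum>i\<le>t-j. coeff (coeff f j) i * x ^ i * y ^ j)"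
      by (simp add: sum_distrib_right)
  qed
  also have "\<dots> = (\<Sum>(j, i)\<in>tri t. coeff (coeff f j) i * x ^ i * y ^ j)"
    unfolding tri_def by (subst sum.Sigma) auto
  also have "\<dots> = (\<Sum>(i, j)\<in>tri t. coeff (coeff f j) i * x ^ i * y ^ j)"
    by (rule sum.reindex_bij_witness[of _ prod.swap prod.swap]) auto
  finally show ?thesis .
qed

text \<open>By pseudo-division an element of least degree in the ideal divides a nonzero constant multiple of
  every element, so by Gauss's lemma its primitive part is a common divisor.\<close>

lemma coprime_elimination:
  fixes f g :: "complex poly poly"
  assumes "coprime f g" "f \<noteq> 0"
  obtains a b u where "u \<noteq> 0" "a * f + b * g = [:u:]"
proof -
  define I where "I = {a * f + b * g | a b. True}"
  have I_add: "p + q \<in> I" if "p \<in> I" "q \<in> I" for p q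
  proof -
    from that obtain a b a' b' where "p = a * f + b * g" "q = a' * f + b' * g" by (auto simp: I_def)
    then have "p + q = (a + a') * f + (b + b') * g" by (simp add: algebra_simps)
    then show ?thesis unfolding I_def by blast
  qed
  have I_mult: "c * p \<in> I" if "p \<in> I" for c p
  proof -
    from that obtain a b where "p = a * f + b * g" by (auto simp: I_def)
    then have "c * p = (c * a) * f + (c * b) * g" by (simp add: algebra_simps)
    then show ?thesis unfolding I_def by blast
  qed
  have fg: "f \<in> I" "g \<in> I" unfolding I_def
    by (auto intro: exI[of _ 1] exI[of _ 0])
  obtain h where h: "h \<in> I" "h \<noteq> 0" "\<And>p. p \<in> I \<Longrightarrow> p \<noteq> 0 \<Longrightarrow> degree h \<le> degree p"
    using ex_has_least_nat[of "\<lambda>h. h \<in> I \<and> h \<noteq> 0" f degree] fg assms(2) by blast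
  have pp: "primitive_part h dvd p" if "p \<in> I" for p
  proof -
    obtain a q where a: "a \<noteq> 0" "smult a p = h * q + pseudo_mod p h"
      and r: "pseudo_mod p h = 0 \<or> degree (pseudo_mod p h) < degree h"
      using pseudo_mod[OF h(2), of p] by blast
    have "pseudo_mod p h = [:a:] * p + (- q) * h" using a(2) by (simp add: algebra_simps)
    then have "pseudo_mod p h \<in> I" using I_add I_mult that h(1) by metis
    with r h(3) have "pseudo_mod p h = 0" by (metis leD)
    with a have "primitive_part h dvd smult a p"
      by (metis add.right_neutral content_times_primitive_part dvd_smult dvd_triv_left dvd_mult2 dvd_refl)
    then have "fract_poly (primitive_part h) dvd fract_poly (smult a p)" by (rule fract_poly_dvd)
    then have "fract_poly (primitive_part h) dvd fract_poly p"
      using a(1) by (simp add: fract_poly_smult dvd_smult_iff)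
    then show ?thesis using h(2) by (intro fract_poly_dvdD) auto
  qed
  from pp[OF fg(1)] pp[OF fg(2)] assms(1) have "is_unit (primitive_part h)"
    by (simp add: coprime_common_divisor)
  then have "degree h = 0" by (metis degree_primitive_part degree_pCons_0 is_unit_poly_iff)
  then obtain u where "h = [:u:]" by (rule degree_eq_zeroE)
  with h that show ?thesis by (auto simp: I_def)
qed

section \<open>Complete intersections in the affine plane\<close>

definition specialize :: "complex \<Rightarrow> complex poly poly \<Rightarrow> complex poly" where
  "specialize x f = map_poly (\<lambda>c. poly c x) f"

lemma coeff_specialize [simp]: "coeff (specialize x f) i = poly (coeff f i) x"
  by (simp add: specialize_def coeff_map_poly)

lemma specialize_diff: "specialize x (f - g) = specialize x f - specialize x g"
  by (rule poly_eqI) simp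

lemma specialize_mult: "specialize x (f * g) = specialize x f * specialize x g"
  by (rule poly_eqI) (simp add: coeff_mult poly_sum)

lemma poly_specialize: "poly (specialize x f) y = poly2 f x y"
proof (induction f)
  case (pCons h f)
  have "specialize x (pCons h f) = pCons (poly h x) (specialize x f)"
    by (simp add: specialize_def map_poly_pCons)
  with pCons show ?case by simp
qed (simp add: specialize_def)

definition lift_poly :: "complex poly \<Rightarrow> complex poly poly" where
  "lift_poly p = map_poly (\<lambda>c. [:c:]) p"

lemma coeff_lift_poly [simp]: "coeff (lift_poly p) i = [:coeff p i:]"
  by (simp add: lift_poly_def coeff_map_poly)

lemma specialize_lift_poly: "specialize x (lift_poly p) = p"
  by (rule poly_eqI) simp

lemma lift_poly_degbound: "degree p \<le> t \<Longrightarrow> lift_poly p \<in> degbound t"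
  by (rule degboundI) (use le_degree le_trans in fastforce)

text \<open>In a Bezout representation of \<open>h\<close> the cofactor of \<open>g\<close> is
  reduced modulo \<open>f\<close>, so its product with \<open>g\<close> has degree at most 2e - 1,
  which is at most \<open>t\<close>. The degree of the other cofactor follows by comparison.\<close>

lemma coprime_univariate_decomposition:
  fixes f g h :: "complex poly"
  assumes "coprime f g" "f \<noteq> 0" "degree f = e" "degree g \<le> e" "degree h \<le> t" "2 * e \<le> Suc t"
  obtains \<alpha> \<beta> where "h = \<alpha> * f + \<beta> * g" "degree \<alpha> \<le> t - e" "degree \<beta> \<le> t - e"
proof -
  obtain a b where ab: "a * f + b * g = 1"
    using assms(1) bezout_coefficients_fst_snd[of f g] by (metis coprime_iff_gcd_eq_1)
  define \<beta> where "\<beta> = (h * b) mod f"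
  define \<alpha> where "\<alpha> = h * a + (h * b) div f * g"
  have "\<beta> = h * b - (h * b) div f * f" by (simp add: \<beta>_def minus_div_mult_eq_mod)
  then have "\<alpha> * f + \<beta> * g = h * (a * f + b * g)" unfolding \<alpha>_def by algebra
  then have h: "h = \<alpha> * f + \<beta> * g" by (simp add: ab)
  have \<beta>: "\<beta> = 0 \<or> degree \<beta> < e" using degree_mod_less[OF assms(2), of "h * b"] assms(3) by (simp add: \<beta>_def)
  then have "degree \<beta> \<le> t - e" using assms(6) by auto
  moreover have "degree \<alpha> \<le> t - e"
  proof (cases "\<alpha> = 0")
    case False
    have "degree (\<beta> * g) \<le> t" using \<beta> assms(4,6) degree_mult_le[of \<beta> g] by auto
    then have "degree (h - \<beta> * g) \<le> t" using assms(5) by (simp add: degree_diff_le)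
    moreover have "h - \<beta> * g = \<alpha> * f" using h by simp
    ultimately show ?thesis using degree_mult_eq[OF False assms(2)] assms(3) by simp
  qed simp
  ultimately show ?thesis using that h by blast
qed

text \<open>On the vertical line at \<open>x\<close> the restrictions of \<open>f\<close> and
  \<open>g\<close> have no common root and are therefore coprime, so the restriction of
  \<open>h\<close> decomposes. Subtracting the lifted decomposition leaves a polynomial vanishing on
  the line, and dividing by the equation of the line lowers the degree by one.\<close>

lemma coprime_decomposition:
  assumes f: "f \<in> degbound e" "degree f = e" "f \<noteq> 0" and g: "g \<in> degbound e"
    and x: "\<And>y. poly2 f x y = 0 \<Longrightarrow> poly2 g x y \<noteq> 0"
    and h: "h \<in> degbound t" and t: "2 * e \<le> Suc t"
  obtains h' \<alpha> \<beta> where "h = [:[:-x, 1:]:] * h' + \<alpha> * f + \<beta> * g" "h' \<in> degbound (t - 1)"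
proof -
  \<comment> \<open>The degree bound makes the coefficient of y^e constant in x, so restriction to a
    line preserves the degree of \<open>f\<close>.\<close>
  have "coeff f e \<noteq> 0" using f by auto
  moreover from this have "degree (coeff f e) = 0" using degboundD[OF f(1), of e] by simp
  ultimately have "poly (coeff f e) x \<noteq> 0" by (auto elim!: degree_eq_zeroE)
  then have sfe: "coeff (specialize x f) e \<noteq> 0" by simp
  have deg: "degree (specialize x p) \<le> s" if "p \<in> degbound s" for p s
    using degbound_degree[OF that] by (intro degree_le) (auto simp: coeff_eq_0)
  have sf: "degree (specialize x f) = e" "specialize x f \<noteq> 0"
    using deg[OF f(1)] le_degree[OF sfe] sfe by (auto simp del: coeff_specialize)
  have "coprime (specialize x f) (specialize x g)"
  proof (rule ccontr)
    assume "\<not> ?thesis"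
    then obtain c where c: "c dvd specialize x f" "c dvd specialize x g" "\<not> is_unit c"
      by (rule not_coprimeE)
    with sf(2) have "c \<noteq> 0" by auto
    with c(3) have "degree c \<noteq> 0" by (simp add: is_unit_iff_degree)
    then obtain y where "poly c y = 0"
      using fundamental_theorem_of_algebra[of c] by (auto simp: constant_degree)
    with c(1,2) have "poly (specialize x f) y = 0" "poly (specialize x g) y = 0"
      by (auto elim!: dvdE)
    with x[of y] show False by (simp add: poly_specialize)
  qed
  then obtain \<alpha> \<beta> where ab: "specialize x h = \<alpha> * specialize x f + \<beta> * specialize x g" 
    "degree \<alpha> \<le> t - e" "degree \<beta> \<le> t - e"
    using coprime_univariate_decomposition[OF _ sf(2,1) deg[OF g] deg[OF h] t] by blast
  define r where "r = h - lift_poly \<alpha> * f - lift_poly \<beta> * g"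
  have et: "t - e + e = t" using t by simp
  have "lift_poly \<alpha> * f \<in> degbound t" "lift_poly \<beta> * g \<in> degbound t"
    using degbound_mult[OF lift_poly_degbound[OF ab(2)] f(1)] degbound_mult[OF lift_poly_degbound[OF ab(3)] g] et by simp_all
  then have r: "r \<in> degbound t" using h by (simp add: r_def degbound_diff)
  have "specialize x r = 0" by (simp add: r_def specialize_diff specialize_mult specialize_lift_poly ab(1))
  then have "poly (coeff r i) x = 0" for i by (metis coeff_specialize coeff_0)
  then have dvd: "[:-x, 1:] dvd coeff r i" for i by (simp add: poly_eq_0_iff_dvd)
  define h' where "h' = map_poly (\<lambda>c. c div [:-x, 1:]) r"
  then have "coeff h' i = coeff r i div [:-x, 1:]" for i by (simp add: coeff_map_poly)
  with dvd have rh': "coeff r i = [:-x, 1:] * coeff h' i" for i by (metis dvd_mult_div_cancel)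
  then have "r = [:[:-x, 1:]:] * h'" by (intro poly_eqI) simp
  moreover have "h' \<in> degbound (t - 1)"
  proof (rule degboundI)
    fix i assume i: "coeff h' i \<noteq> 0"
    then have "degree (coeff r i) = Suc (degree (coeff h' i))" unfolding rh' by (subst degree_mult_eq) auto
    moreover have "coeff r i \<noteq> 0" using i unfolding rh' by (metis mult_eq_0_iff one_neq_zero pCons_eq_0_iff)
    ultimately show "degree (coeff h' i) + i \<le> t - 1" using degboundD[OF r, of i] by simp
  qed
  ultimately show ?thesis
    using that[of h' "lift_poly \<alpha>" "lift_poly \<beta>"] by (simp add: r_def algebra_simps)
qed

text \<open>Dividing the weights by the equation of a line missing the intersection raises the
  degree in which they annihilate all polynomials, until the points can be separated.\<close>

lemma complete_intersection_weights_zero: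
  fixes xs ys w :: "'a \<Rightarrow> complex"
  assumes Z: "finite Z" "\<And>p q. p \<in> Z \<Longrightarrow> q \<in> Z \<Longrightarrow> xs p = xs q \<Longrightarrow> ys p = ys q \<Longrightarrow> p = q"
    and f: "f \<in> degbound e" "degree f = e" "f \<noteq> 0" and g: "g \<in> degbound e" and "coprime f g"
    and van: "\<And>p. p \<in> Z \<Longrightarrow> poly2 f (xs p) (ys p) = 0" "\<And>p. p \<in> Z \<Longrightarrow> poly2 g (xs p) (ys p) = 0"
    and w: "\<And>h. h \<in> degbound t \<Longrightarrow> (\<Sum>p\<in>Z. w p * poly2 h (xs p) (ys p)) = 0"
    and t: "2 * e \<le> Suc t" and p: "p \<in> Z"
  shows "w p = 0"
proof -
  obtain a b u where u: "u \<noteq> 0" "a * f + b * g = [:u:]"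
    by (rule coprime_elimination[OF \<open>coprime f g\<close> f(3)])
  \<comment> \<open>Since \<open>u\<close> lies in the ideal of \<open>f\<close> and
    \<open>g\<close>, the line x = \<open>x0\<close> contains no common zero of them.\<close>
  obtain x0 where x0: "poly u x0 \<noteq> 0" using u(1) poly_all_0_iff_0 by blast
  have u_eq: "poly u x = poly2 a x y * poly2 f x y + poly2 b x y * poly2 g x y" for x y
    using arg_cong[OF u(2), of "\<lambda>f. poly2 f x y"] by (simp del: poly2_simps(8))
  have no_zero: "poly2 g x0 y \<noteq> 0" if "poly2 f x0 y = 0" for y
    using u_eq[of x0 y] x0 that by auto
  have xs: "xs p \<noteq> x0" if "p \<in> Z" for p
    using u_eq[of "xs p" "ys p"] van[OF that] x0 by auto
  \<comment> \<open>On \<open>Z\<close>, where \<open>f\<close> and \<open>g\<close> vanish,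
    \<open>h\<close> agrees with (x - x0) times \<open>h'\<close>; the extra factor cancels one
    division of the weights.\<close>
  have kill: "(\<Sum>p\<in>Z. w p / (xs p - x0) ^ i * poly2 h (xs p) (ys p)) = 0" if "h \<in> degbound (t + i)" for i h
    using that
  proof (induction i arbitrary: h)
    case (Suc i)
    have t': "2 * e \<le> Suc (t + Suc i)" using t by simp
    obtain h' \<alpha> \<beta> where h: "h = [:[:-x0, 1:]:] * h' + \<alpha> * f + \<beta> * g" "h' \<in> degbound (t + Suc i - 1)"
      by (rule coprime_decomposition[OF f g no_zero Suc.prems t'])
    from h(2) have h': "h' \<in> degbound (t + i)" by simp
    have "w p / (xs p - x0) ^ Suc i * poly2 h (xs p) (ys p) = w p / (xs p - x0) ^ i * poly2 h' (xs p) (ys p)" if "p \<in> Z" for p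
      using xs[OF that] van[OF that] by (simp add: h(1) divide_simps)
    then show ?case using Suc.IH[OF h'] by simp
  qed (use w in simp)
  \<comment> \<open>A vertical line through \<open>q\<close>, or a horizontal one when
    \<open>q\<close> and \<open>p\<close> share their x-coordinate; distinct points cannot share
    both.\<close>
  define l where "l q = (if xs q \<noteq> xs p then [:[:-xs q, 1:]:] else [:[:-ys q:], 1:])" for q
  have l: "poly2 (l q) (xs q) (ys q) = 0" "q \<in> Z - {p} \<Longrightarrow> poly2 (l q) (xs p) (ys p) \<noteq> 0" for q
    using Z(2)[of p q] p by (auto simp: l_def)
  define h where "h = (\<Prod>q\<in>Z-{p}. l q)"
  have h: "poly2 h x y = (\<Prod>q\<in>Z-{p}. poly2 (l q) x y)" for x y
    by (simp add: h_def poly2_def poly_prod)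
  \<comment> \<open>Any degree bound for the separating product will do, since \<open>kill\<close>
    covers every degree from \<open>t\<close> on.\<close>
  obtain s where "h \<in> degbound s" using degbound_exists by blast
  then have "h \<in> degbound (t + s)" by (rule degbound_mono) simp
  from kill[OF this] have "(\<Sum>q\<in>Z. w q / (xs q - x0) ^ s * poly2 h (xs q) (ys q)) = 0" .
  moreover have "poly2 h (xs q) (ys q) = 0" if "q \<in> Z - {p}" for q
    unfolding h using that Z(1) l(1) by (intro prod_zero) auto
  ultimately have "w p / (xs p - x0) ^ s * poly2 h (xs p) (ys p) = 0"
    using Z(1) p by (simp add: sum.remove[OF Z(1) p])
  moreover have "poly2 h (xs p) (ys p) \<noteq> 0" unfolding h using Z(1) l(2) by simp
  ultimately show ?thesis using xs[OF p] by simp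
qed

section \<open>Decompositions supported on points of the plane\<close>

lemma coeff_mult_top:
  assumes "degree f \<le> s" "degree g \<le> t"
  shows "coeff (f * g) (s + t) = coeff f s * coeff g t"
proof -
  have "coeff (f * g) (s + t) = (\<Sum>i\<le>s+t. if i = s then coeff f s * coeff g t else 0)"
    unfolding coeff_mult
  proof (intro sum.cong refl)
    fix i assume "i \<in> {..s+t}"
    then show "coeff f i * coeff g (s + t - i) = (if i = s then coeff f s * coeff g t else 0)"
      using assms coeff_eq_0[of f i] coeff_eq_0[of g "s + t - i"] by (cases i s rule: linorder_cases) auto
  qed
  then show ?thesis by simp
qed

text \<open>The affine chart whose line at infinity passes through v; the parameter s selects that line among
  the lines through v.\<close>

definition chart :: "complex \<Rightarrow> complex ^ 3 \<Rightarrow> complex \<Rightarrow> complex \<Rightarrow> complex ^ 3" where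
  "chart s v x y = vector [1 - s * x + v $ 1 * y, x + v $ 2 * y, y]"

lemma chart_nth [simp]:
  "chart s v x y $ 1 = 1 - s * x + v $ 1 * y"
  "chart s v x y $ 2 = x + v $ 2 * y"
  "chart s v x y $ 3 = y"
  by (simp_all add: chart_def)

text \<open>The linear form that equals 1 on the image of the chart. If the last coordinate of
  \<open>v\<close> is 1, it vanishes at \<open>v\<close>; its zero line is the line at
  infinity.\<close>

definition denom :: "complex \<Rightarrow> complex ^ 3 \<Rightarrow> complex ^ 3 \<Rightarrow> complex" where
  "denom s v p = (p $ 1 - v $ 1 * p $ 3) + s * (p $ 2 - v $ 2 * p $ 3)"

definition xcoord :: "complex \<Rightarrow> complex ^ 3 \<Rightarrow> complex ^ 3 \<Rightarrow> complex" where
  "xcoord s v p = (p $ 2 - v $ 2 * p $ 3) / denom s v p"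

definition ycoord :: "complex \<Rightarrow> complex ^ 3 \<Rightarrow> complex ^ 3 \<Rightarrow> complex" where
  "ycoord s v p = p $ 3 / denom s v p"

lemma chart_coords:
  assumes "denom s v p \<noteq> 0"
  shows "p = denom s v p *s chart s v (xcoord s v p) (ycoord s v p)"
proof -
  define l where "l = denom s v p"
  have l: "l \<noteq> 0" "l = (p $ 1 - v $ 1 * p $ 3) + s * (p $ 2 - v $ 2 * p $ 3)"
    using assms by (simp_all add: l_def denom_def)
  have "l * (1 - s * ((p $ 2 - v $ 2 * p $ 3) / l) + v $ 1 * (p $ 3 / l)) =
    l - s * (p $ 2 - v $ 2 * p $ 3) + v $ 1 * p $ 3" using l(1) by (simp add: field_simps)
  also have "\<dots> = p $ 1" by (simp add: l(2))
  finally have 1: "p $ 1 = l * (1 - s * ((p $ 2 - v $ 2 * p $ 3) / l) + v $ 1 * (p $ 3 / l))" ..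
  have 2: "p $ 2 = l * ((p $ 2 - v $ 2 * p $ 3) / l + v $ 2 * (p $ 3 / l))"
    using l(1) by (simp add: field_simps)
  show ?thesis unfolding xcoord_def ycoord_def l_def[symmetric] vec_eq_iff
    using 1 2 l(1) by (simp add: forall_3)
qed

lemma coords_chart [simp]:
  "denom s v (chart s v x y) = 1" "xcoord s v (chart s v x y) = x" "ycoord s v (chart s v x y) = y"
  by (simp_all add: denom_def xcoord_def ycoord_def)

lemma hforms_denom: "denom s v \<in> hforms 1"
  unfolding denom_def[abs_def] by (intro hforms_add hforms_diff hforms_scale hforms_coord)

text \<open>The last clause records the value at infinity: when the last coordinate of
  \<open>v\<close> is 1, \<open>chart s v x y\<close> divided by y tends to \<open>v\<close> as y
  grows. Thus a nonzero value at \<open>v\<close> means degree exactly \<open>t\<close> in y with a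
  constant leading coefficient.\<close>

definition dehomogenization :: "complex \<Rightarrow> complex ^ 3 \<Rightarrow> nat \<Rightarrow> (complex ^ 3 \<Rightarrow> complex) \<Rightarrow> complex poly poly \<Rightarrow> bool" where
  "dehomogenization s v t F f \<longleftrightarrow>
     f \<in> degbound t \<and> (\<forall>x y. F (chart s v x y) = poly2 f x y) \<and> coeff f t = [:F v:]"

lemma dehomogenization_mult:
  assumes "dehomogenization s v a F f" "dehomogenization s v b G g"
  shows "dehomogenization s v (a + b) (\<lambda>p. F p * G p) (f * g)"
  using assms unfolding dehomogenization_def
  by (auto intro: degbound_mult simp: coeff_mult_top degbound_degree)

lemma dehomogenization_const: "dehomogenization s v 0 (\<lambda>p. c) [:[:c:]:]"
  unfolding dehomogenization_def by (auto intro!: degboundI simp: coeff_pCons split: nat.splits)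

lemma dehomogenization_power:
  assumes "dehomogenization s v 1 F f"
  shows "dehomogenization s v n (\<lambda>p. F p ^ n) (f ^ n)"
proof (induction n)
  case 0
  show ?case using dehomogenization_const[of s v 1] by (simp add: one_pCons)
next
  case (Suc n)
  show ?case using dehomogenization_mult[OF assms Suc] by simp
qed

lemma dehomogenization_coord:
  assumes "v $ 3 = 1"
  shows "dehomogenization s v 1 (\<lambda>p. p $ 1) [:[:1, -s:], [:v $ 1:]:]"
    and "dehomogenization s v 1 (\<lambda>p. p $ 2) [:[:0, 1:], [:v $ 2:]:]"
    and "dehomogenization s v 1 (\<lambda>p. p $ 3) [:0, 1:]"
  using assms unfolding dehomogenization_def
  by (auto intro!: degboundI simp: coeff_pCons degree_pCons_eq_if one_pCons algebra_simps split: nat.splits if_splits)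

lemma dehomogenization_exists:
  assumes "F \<in> hforms t" "v $ 3 = 1"
  obtains f where "dehomogenization s v t F f"
proof -
  obtain c where c: "\<And>p. F p = (\<Sum>e\<in>tri t. c e * tmono t e p)"
    using hforms_expand[OF assms(1)] by blast
  have "\<exists>f. dehomogenization s v t (tmono t e) f" if e: "e \<in> tri t" for e
  proof -
    note d = dehomogenization_coord[OF assms(2), of s]
    have "fst e + snd e + (t - fst e - snd e) = t" using e by (cases e) auto
    then show ?thesis unfolding tmono_def[abs_def]
      using dehomogenization_mult[OF dehomogenization_mult[OF dehomogenization_power[OF d(1), of "fst e"]
        dehomogenization_power[OF d(2), of "snd e"]] dehomogenization_power[OF d(3), of "t - fst e - snd e"]]
      by auto
  qed
  then obtain m where m: "\<And>e. e \<in> tri t \<Longrightarrow> dehomogenization s v t (tmono t e) (m e)" by metis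
  have m': "dehomogenization s v t (\<lambda>p. c e * tmono t e p) ([:[:c e:]:] * m e)" if "e \<in> tri t" for e
    using dehomogenization_mult[OF dehomogenization_const m[OF that], of "c e"] by simp
  have "dehomogenization s v t F (\<Sum>e\<in>tri t. [:[:c e:]:] * m e)"
    unfolding dehomogenization_def
  proof (intro conjI allI degbound_sum)
    show "[:[:c e:]:] * m e \<in> degbound t" if "e \<in> tri t" for e
      using m'[OF that] by (simp only: dehomogenization_def)
    show "F (chart s v x y) = poly2 (\<Sum>e\<in>tri t. [:[:c e:]:] * m e) x y" for x y
      unfolding c poly2_sum using m' by (intro sum.cong refl) (simp only: dehomogenization_def)
    have "coeff (\<Sum>e\<in>tri t. [:[:c e:]:] * m e) t = (\<Sum>e\<in>tri t. [:c e * tmono t e v:])"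
      unfolding coeff_sum using m' by (intro sum.cong refl) (simp only: dehomogenization_def)
    also have "\<dots> = [:F v:]" unfolding c
      by (rule poly_eqI) (simp add: coeff_sum coeff_pCons split: nat.splits)
    finally show "coeff (\<Sum>e\<in>tri t. [:[:c e:]:] * m e) t = [:F v:]" .
  qed
  then show ?thesis by (rule that)
qed

text \<open>The bound \<open>m\<close> may exceed the actual degree; powers of \<open>denom\<close>
  fill the gap.\<close>

lemma homogenization_exists:
  assumes "q \<in> degbound m"
  obtains Q where "Q \<in> hforms m"
    "\<And>p. denom s v p \<noteq> 0 \<Longrightarrow> Q p = denom s v p ^ m * poly2 q (xcoord s v p) (ycoord s v p)"
proof -
  define B where "B = (\<lambda>p :: complex^3. p $ 2 - v $ 2 * p $ 3)"
  define M where "M e = (\<lambda>p. denom s v p ^ (m - fst e - snd e) * B p ^ fst e * p $ 3 ^ snd e)" for e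
  define Q where "Q = (\<lambda>p. \<Sum>e\<in>tri m. coeff (coeff q (snd e)) (fst e) * M e p)"
  have "B \<in> hforms 1" unfolding B_def by (intro hforms_diff hforms_scale hforms_coord)
  then have "M e \<in> hforms ((m - fst e - snd e) * 1 + fst e * 1 + snd e * 1)" for e
    unfolding M_def by (intro hforms_mult hforms_power hforms_denom hforms_coord)
  moreover have "(m - fst e - snd e) * 1 + fst e * 1 + snd e * 1 = m" if "e \<in> tri m" for e
    using that by (cases e) auto
  ultimately have "M e \<in> hforms m" if "e \<in> tri m" for e using that by metis
  then have "Q \<in> hforms m" unfolding Q_def by (intro hforms_sum hforms_scale)
  moreover have "Q p = denom s v p ^ m * poly2 q (xcoord s v p) (ycoord s v p)" if "denom s v p \<noteq> 0" for p
  proof -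
    have "M e p = denom s v p ^ m * (xcoord s v p ^ fst e * ycoord s v p ^ snd e)" if "e \<in> tri m" for e
    proof -
      have "denom s v p ^ m = denom s v p ^ ((m - fst e - snd e) + fst e + snd e)" using that by (cases e) auto
      then show ?thesis using \<open>denom s v p \<noteq> 0\<close>
        by (simp add: M_def B_def xcoord_def ycoord_def power_add power_divide)
    qed
    then show ?thesis unfolding Q_def poly2_expand[OF assms] sum_distrib_left
      by (intro sum.cong refl) (simp add: case_prod_unfold)
  qed
  ultimately show ?thesis by (rule that)
qed

definition proj_distinct :: "(complex ^ 3) set \<Rightarrow> bool" where
  "proj_distinct X \<longleftrightarrow> 0 \<notin> X \<and> (\<forall>p\<in>X. \<forall>q\<in>X. \<forall>a. p = a *s q \<longrightarrow> p = q)"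

lemma proj_distinct_subset: "proj_distinct X \<Longrightarrow> Y \<subseteq> X \<Longrightarrow> proj_distinct Y"
  by (auto simp: proj_distinct_def)

text \<open>A point different from \<open>v\<close> lies on only one line through \<open>v\<close>,
  so each point of \<open>Z\<close> excludes at most one parameter.\<close>

lemma exists_denom_nonzero:
  assumes "finite Z" "\<And>p a. p \<in> Z \<Longrightarrow> p \<noteq> a *s v" "v $ 3 = 1"
  obtains s where "\<And>p. p \<in> Z \<Longrightarrow> denom s v p \<noteq> 0"
proof -
  have "finite {s. denom s v p = 0}" if "p \<in> Z" for p
  proof (cases "p $ 2 - v $ 2 * p $ 3 = 0")
    case True
    have "p $ 1 - v $ 1 * p $ 3 \<noteq> 0"
    proof
      assume "p $ 1 - v $ 1 * p $ 3 = 0"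
      with True assms(3) have "p = (p $ 3) *s v" by (simp add: vec_eq_iff forall_3)
      with assms(2)[OF that] show False by blast
    qed
    with True show ?thesis by (simp add: denom_def)
  next
    case False
    then have "{s. denom s v p = 0} \<subseteq> {- (p $ 1 - v $ 1 * p $ 3) / (p $ 2 - v $ 2 * p $ 3)}"
      by (auto simp: denom_def eq_divide_eq add_eq_0_iff)
    then show ?thesis by (rule finite_subset) simp
  qed
  with assms(1) have "finite (\<Union>p\<in>Z. {s. denom s v p = 0})" by blast
  then obtain s where "s \<notin> (\<Union>p\<in>Z. {s. denom s v p = 0})"
    using ex_new_if_finite[OF infinite_UNIV_char_0] by blast
  with that show ?thesis by blast
qed

text \<open>Q is the greatest common divisor of F and G, computed in a chart in which v is the point at
  infinity of the y-axis; F not vanishing at v, it becomes monic in y up to a constant.\<close>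

lemma weights_supported_on_lower_degree_curve:
  assumes Z: "finite Z" "proj_distinct Z"
    and FG: "F \<in> hforms k" "G \<in> hforms k" and van: "\<And>p. p \<in> Z \<Longrightarrow> F p = 0" "\<And>p. p \<in> Z \<Longrightarrow> G p = 0"
    and v: "v $ 3 = 1" "F v \<noteq> 0" "G v = 0" and u: "G u \<noteq> 0"
    and w: "\<And>H. H \<in> hforms d \<Longrightarrow> (\<Sum>p\<in>Z. w p * H p) = 0"
    and d: "2 * k \<le> Suc d"
  obtains Q u where "Q \<in> hforms (k - 1)" "Q u \<noteq> 0" "\<And>p. p \<in> Z \<Longrightarrow> w p * Q p = 0"
proof -
  \<comment> \<open>No point of \<open>Z\<close> is \<open>v\<close>, because \<open>F\<close>
    vanishes on \<open>Z\<close> but not at \<open>v\<close>. The point \<open>u\<close> is kept off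
    infinity too, so that the dehomogenization of \<open>G\<close> is not zero.\<close>
  have "p \<noteq> a *s v" if "p \<in> insert u Z" for p a
  proof
    assume p: "p = a *s v"
    have "p \<noteq> u" using p u v(3) hforms_homogeneous[OF FG(2), of a v] by auto
    with that have pZ: "p \<in> Z" by simp
    then have "a ^ k * F v = 0" using van(1) hforms_homogeneous[OF FG(1), of a v] p by metis
    then have "a = 0" using v(2) by simp
    then show False using p pZ Z(2) by (simp add: proj_distinct_def)
  qed
  then obtain s where s: "\<And>p. p \<in> insert u Z \<Longrightarrow> denom s v p \<noteq> 0"
    using exists_denom_nonzero[of "insert u Z" v] Z(1) v(1) by blast
  let ?l = "denom s v" and ?x = "xcoord s v" and ?y = "ycoord s v"
  have hom: "H p = ?l p ^ t * poly2 h (?x p) (?y p)"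
    if "H \<in> hforms t" "dehomogenization s v t H h" "p \<in> insert u Z" for H h t p
    using hforms_homogeneous[OF that(1), of "?l p" "chart s v (?x p) (?y p)"] that(2) 
      chart_coords[OF s[OF that(3)]] unfolding dehomogenization_def by metis
  obtain f where f: "dehomogenization s v k F f" by (rule dehomogenization_exists[OF FG(1) v(1)])
  obtain g where g: "dehomogenization s v k G g" by (rule dehomogenization_exists[OF FG(2) v(1)])
  have cf: "coeff f k \<noteq> 0" and fk: "f \<in> degbound k" and cg: "coeff g k = 0" and gk: "g \<in> degbound k"
    using f g v(2,3) by (auto simp: dehomogenization_def)
  then have df: "degree f = k" and f0: "f \<noteq> 0" using degbound_degree[OF fk] le_degree[OF cf] by auto
  have g0: "g \<noteq> 0" using hom[OF FG(2) g, of u] u by auto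
  have fz: "poly2 f (?x p) (?y p) = 0" and gz: "poly2 g (?x p) (?y p) = 0" if "p \<in> Z" for p
    using hom[OF FG(1) f, of p] hom[OF FG(2) g, of p] van[OF that] s[of p] that by auto
  define q where "q = gcd f g"
  have q0: "q \<noteq> 0" using f0 by (simp add: q_def)
  obtain f' g' where f': "f = f' * q" and g': "g = g' * q" and cop: "coprime f' g'"
    using gcd_coprime_exists[of f g] q0 unfolding q_def by blast
  have f'0: "f' \<noteq> 0" and g'0: "g' \<noteq> 0" using f0 g0 f' g' by auto
  define e where "e = degree f'"
  define j where "j = degree q"
  have ejk: "e + j = k" using df degree_mult_eq[OF f'0 q0] by (simp add: f' e_def j_def)
  \<comment> \<open>The degree of \<open>f\<close> in y already exhausts the bound \<open>k\<close>,
    so for each of its two factors the total degree equals the degree in y. This fixes the degree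
    left for \<open>g'\<close>.\<close>
  obtain a b where ab: "f' \<in> degbound a" "q \<in> degbound b" "a + b \<le> k"
    using degbound_multD[of f' q k] fk f'0 q0 f' by blast
  have "e \<le> a" "j \<le> b" using degbound_degree[OF ab(1)] degbound_degree[OF ab(2)] by (auto simp: e_def j_def)
  with ab ejk have "a = e" "b = j" by auto
  with ab have f'e: "f' \<in> degbound e" and qj: "q \<in> degbound j" by auto
  obtain a' b' where ab': "g' \<in> degbound a'" "q \<in> degbound b'" "a' + b' \<le> k"
    using degbound_multD[of g' q k] gk g'0 q0 g' by blast
  have "j \<le> b'" using degbound_degree[OF ab'(2)] by (simp add: j_def)
  with ab' ejk have g'e: "g' \<in> degbound e" using degbound_mono[of g' a' e] by simp
  \<comment> \<open>Otherwise \<open>f'\<close> and \<open>g'\<close> are constants and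
    \<open>g\<close> is a nonzero multiple of \<open>f\<close>, against \<open>G v = 0\<close> and
    \<open>F v \<noteq> 0\<close>. This is where independence of the two forms lowers the degree of
    the curve.\<close>
  have "e \<noteq> 0"
  proof
    assume e: "e = 0"
    have "coeff g k = coeff g' e * coeff q j"
      using coeff_mult_top[of g' e q j] degbound_degree[OF g'e] ejk by (simp add: g' j_def)
    then have "coeff g' 0 = 0" using cg q0 e by (simp add: j_def)
    moreover have "degree g' = 0" using degbound_degree[OF g'e] e by simp
    ultimately show False using g'0 leading_coeff_0_iff[of g'] by simp
  qed
  then have jk: "j \<le> k - 1" using ejk by simp
  obtain Q where Q: "Q \<in> hforms (k - 1)"
    "\<And>p. ?l p \<noteq> 0 \<Longrightarrow> Q p = ?l p ^ (k - 1) * poly2 q (?x p) (?y p)"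
    using homogenization_exists[OF degbound_mono[OF qj jk], where s = s and v = v] by blast
  obtain x y where xy: "poly2 q x y \<noteq> 0" by (rule poly2_nonzero[OF q0])
  have "Q (chart s v x y) \<noteq> 0" using Q(2)[of "chart s v x y"] xy by simp
  moreover have "w p * Q p = 0" if p: "p \<in> Z" for p
  proof (cases "poly2 q (?x p) (?y p) = 0")
    case True
    then show ?thesis using Q(2)[OF s] p by simp
  next
    case False
    define Z' where "Z' = {p\<in>Z. poly2 q (?x p) (?y p) \<noteq> 0}"
    \<comment> \<open>Weights multiplied by \<open>q\<close> annihilate degree \<open>d - j\<close>,
      since \<open>q * h\<close> has degree at most \<open>d\<close>. The power of \<open>?l\<close>
      passes from the given vectors to their affine coordinates.\<close>
    have "w p * ?l p ^ d * poly2 q (?x p) (?y p) = 0"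
    proof (rule complete_intersection_weights_zero[where Z = Z' and xs = ?x and ys = ?y and f = f' and e = e and g = g'
        and w = "\<lambda>p. w p * ?l p ^ d * poly2 q (?x p) (?y p)" and t = "d - j"])
      show "finite Z'" "p \<in> Z'" using Z(1) p False by (auto simp: Z'_def)
      show "degree f' = e" by (simp add: e_def)
      show "2 * e \<le> Suc (d - j)" using ejk d jk by auto
      fix p assume p: "p \<in> Z'"
      then show "poly2 f' (?x p) (?y p) = 0" "poly2 g' (?x p) (?y p) = 0"
        using fz[of p] gz[of p] by (auto simp: Z'_def f' g')
      fix p' assume p': "p' \<in> Z'" and eq: "?x p = ?x p'" "?y p = ?y p'"
      have l: "?l p \<noteq> 0" "?l p' \<noteq> 0" using p p' s by (auto simp: Z'_def)
      have "p = ?l p *s chart s v (?x p') (?y p')" "p' = ?l p' *s chart s v (?x p') (?y p')"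
        using chart_coords[OF l(1)] chart_coords[OF l(2)] eq by simp_all
      then have "p = (?l p / ?l p') *s p'"
        using l by (metis nonzero_eq_divide_eq vector_smult_assoc)
      then show "p = p'" using p p' Z(2) unfolding proj_distinct_def Z'_def by blast
    next
      fix h assume h: "h \<in> degbound (d - j)"
      have "j + (d - j) = d" using jk d by simp
      with degbound_mult[OF qj h] have "q * h \<in> degbound d" by simp
      then obtain H where H: "H \<in> hforms d" 
        "\<And>p. ?l p \<noteq> 0 \<Longrightarrow> H p = ?l p ^ d * poly2 (q * h) (?x p) (?y p)"
        using homogenization_exists[where s = s and v = v] by blast
      have "(\<Sum>p\<in>Z'. w p * ?l p ^ d * poly2 q (?x p) (?y p) * poly2 h (?x p) (?y p)) =
        (\<Sum>p\<in>Z. w p * ?l p ^ d * poly2 q (?x p) (?y p) * poly2 h (?x p) (?y p))"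
        using Z(1) by (intro sum.mono_neutral_left) (auto simp: Z'_def)
      also have "\<dots> = (\<Sum>p\<in>Z. w p * H p)"
        using H(2) s by (intro sum.cong) auto
      finally show "(\<Sum>p\<in>Z'. w p * ?l p ^ d * poly2 q (?x p) (?y p) * poly2 h (?x p) (?y p)) = 0"
        using w[OF H(1)] by simp
    qed (use f'e f'0 g'e cop in auto)
    then have "w p = 0" using False s p by simp
    then show ?thesis by simp
  qed
  ultimately show ?thesis using that Q(1) by blast
qed


section \<open>Comparison of two decompositions\<close>

lemma exists_nonzero_coord:
  assumes "(p :: complex ^ 3) \<noteq> 0"
  obtains i where "p $ i \<noteq> 0"
  using assms by (auto simp: vec_eq_iff)

text \<open>As the vectors are not proportional, some minor y_i p_j - y_j p_i is nonzero; with a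
  variable vector in place of \<open>p\<close> it is the equation of the line.\<close>

lemma exists_line_separating:
  fixes p y :: "complex ^ 3"
  assumes "p \<noteq> 0" "\<And>a. p \<noteq> a *s y"  "y \<noteq> 0"
  obtains l where "l \<in> hforms 1" "l y = 0" "l p \<noteq> 0"
proof -
  obtain i where i: "y $ i \<noteq> 0" by (rule exists_nonzero_coord[OF assms(3)])
  have "p \<noteq> (p $ i / y $ i) *s y" by (rule assms(2))
  then obtain j where "p $ j \<noteq> (p $ i / y $ i) * y $ j" by (auto simp: vec_eq_iff)
  then have "y $ i * p $ j - y $ j * p $ i \<noteq> 0" using i by (simp add: field_simps)
  then show ?thesis
    by (intro that[of "\<lambda>z. y $ i * z $ j - y $ j * z $ i"] hforms_diff hforms_scale hforms_coord) auto
qed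

text \<open>If \<open>y\<close> in \<open>Y\<close> were outside \<open>X\<close>, there would be
  separators of \<open>X\<close> in degree \<open>d - n\<close> that all vanish at \<open>y\<close>.
  Their combinations have \<open>card X\<close> parameters against at most \<open>card X - 1\<close>
  remaining conditions from \<open>Y\<close>, so a nontrivial one vanishes on \<open>Y\<close>. The
  relation, tested on its multiples by forms of degree \<open>n\<close>, makes it vanish on
  \<open>X\<close> as well, which separators exclude.\<close>

lemma equal_if_indep_pts:
  assumes fin: "finite X" "finite Y" and dist: "proj_distinct (X \<union> Y)" and ind: "indep_pts n X"
    and d: "2 * n + 1 \<le> d" and card: "card Y \<le> card X"
    and c: "\<And>p. p \<in> X \<Longrightarrow> c p \<noteq> 0"
    and rel: "\<And>F. F \<in> hforms d \<Longrightarrow> (\<Sum>p\<in>X. c p * F p) = (\<Sum>p\<in>Y. b p * F p)"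
  shows "X = Y"
proof
  show YX: "Y \<subseteq> X"
  proof (rule ccontr)
    assume "\<not> Y \<subseteq> X"
    then obtain y where y: "y \<in> Y" "y \<notin> X" by blast
    have "\<forall>p\<in>X. \<exists>E. E \<in> hforms (d - n) \<and> E y = 0 \<and> E p \<noteq> 0 \<and> (\<forall>p'\<in>X-{p}. E p' = 0)"
    proof
      fix p assume p: "p \<in> X"
      obtain G where G: "G \<in> hforms n" "G p = 1" "\<And>p'. p' \<in> X - {p} \<Longrightarrow> G p' = 0"
        using indep_pts_separators[OF fin(1) ind p] by blast
      have py: "p \<noteq> 0" "y \<noteq> 0" "p \<noteq> a *s y" for a
        using dist p y unfolding proj_distinct_def by (metis UnI1 UnI2)+
      obtain l where l: "l \<in> hforms 1" "l y = 0" "l p \<noteq> 0"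
        by (rule exists_line_separating[OF py(1,3,2)])
      obtain i where i: "p $ i \<noteq> 0" by (rule exists_nonzero_coord[OF py(1)])
      \<comment> \<open>The separator has degree \<open>n\<close> and the line degree 1; a power of
        a coordinate nonzero at \<open>p\<close> supplies the remaining
        \<open>d - 2 * n - 1\<close>.\<close>
      let ?E = "\<lambda>z. G z * (l z * (z $ i) ^ (d - 2 * n - 1))"
      have "?E \<in> hforms (n + (1 + (d - 2 * n - 1) * 1))"
        by (intro hforms_mult hforms_power hforms_coord G(1) l(1))
      moreover have "n + (1 + (d - 2 * n - 1) * 1) = d - n" using d by simp
      ultimately have "?E \<in> hforms (d - n)" by (simp only:)
      with l i G show "\<exists>E. E \<in> hforms (d - n) \<and> E y = 0 \<and> E p \<noteq> 0 \<and> (\<forall>p'\<in>X-{p}. E p' = 0)"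
        by (intro exI[of _ ?E]) auto
    qed
    from bchoice[OF this] obtain E where
      "\<forall>p\<in>X. E p \<in> hforms (d - n) \<and> E p y = 0 \<and> E p p \<noteq> 0 \<and> (\<forall>p'\<in>X-{p}. E p p' = 0)" ..
    then have E: "\<And>p. p \<in> X \<Longrightarrow> E p \<in> hforms (d - n)" "\<And>p. p \<in> X \<Longrightarrow> E p y = 0"
      "\<And>p. p \<in> X \<Longrightarrow> E p p \<noteq> 0" "\<And>p p'. p \<in> X \<Longrightarrow> p' \<in> X \<Longrightarrow> p' \<noteq> p \<Longrightarrow> E p p' = 0"
      by simp_all
    \<comment> \<open>The point \<open>y\<close> costs no condition because every \<open>E p\<close>
      vanishes there; this gains the strict inequality.\<close>
    have "card (Y - {y}) < card X" using card fin(2) y(1) by (metis card_Diff1_less less_le_trans)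
    then obtain t where t: "\<exists>p\<in>X. t p \<noteq> 0" "\<And>q. q \<in> Y - {y} \<Longrightarrow> (\<Sum>p\<in>X. E p q * t p) = 0"
      using homogeneous_system_nontrivial_solution[of "Y - {y}" X "\<lambda>q p. E p q"] fin by auto
    define F where "F = (\<lambda>z. \<Sum>p\<in>X. t p * E p z)"
    have F: "F \<in> hforms (d - n)" unfolding F_def by (intro hforms_sum hforms_scale E(1))
    have FY: "F q = 0" if "q \<in> Y" for q
      using t(2)[of q] E(2) that by (cases "q = y") (auto simp: F_def mult.commute)
    have FX: "F p = t p * E p p" if "p \<in> X" for p
    proof -
      have "t x * E x p = 0" if "x \<in> X - {p}" for x using E(4)[of x p] that \<open>p \<in> X\<close> by auto
      then have "(\<Sum>x\<in>X-{p}. t x * E x p) = 0" by (intro sum.neutral ballI)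
      then show ?thesis using that fin(1) unfolding F_def by (subst sum.remove[of _ p]) auto
    qed
    have "c p * F p = 0" if "p \<in> X" for p
    proof (rule indep_ptsD[OF ind _ that])
      fix G assume G: "G \<in> hforms n"
      have "(\<lambda>z. F z * G z) \<in> hforms d" using hforms_mult[OF F G] d by simp
      from rel[OF this] FY show "(\<Sum>x\<in>X. c x * F x * G x) = 0" by (simp add: mult.assoc)
    qed
    with c FX E(3) have "t p = 0" if "p \<in> X" for p using that by auto
    with t(1) show False by blast
  qed
  show "X \<subseteq> Y"
  proof (rule ccontr)
    assume "\<not> X \<subseteq> Y"
    then obtain p where p: "p \<in> X" "p \<notin> Y" by blast
    then obtain i where i: "p $ i \<noteq> 0"
      using dist exists_nonzero_coord[of p] unfolding proj_distinct_def by (metis UnI1)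
    \<comment> \<open>Since \<open>Y\<close> lies in \<open>X\<close>, the difference of both sides
      is a relation on \<open>X\<close> alone; a coordinate power lifts test forms of degree
      \<open>n\<close> to degree \<open>d\<close>.\<close>
    have "(c p - (if p \<in> Y then b p else 0)) * (p $ i) ^ (d - n) = 0"
    proof (rule indep_ptsD[OF ind _ p(1)])
      fix F assume F: "F \<in> hforms n"
      have "(\<lambda>z. (z $ i) ^ (d - n) * F z) \<in> hforms d"
        using hforms_mult[OF hforms_power[OF hforms_coord[of i], of "d - n"] F] d by simp
      from rel[OF this] have "(\<Sum>x\<in>X. c x * ((x $ i) ^ (d - n) * F x)) = (\<Sum>x\<in>Y. b x * ((x $ i) ^ (d - n) * F x))" .
      also have "\<dots> = (\<Sum>x\<in>X. (if x \<in> Y then b x else 0) * ((x $ i) ^ (d - n) * F x))"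
        using fin(1) YX by (intro sum.mono_neutral_cong_left) auto
      finally show "(\<Sum>x\<in>X. (c x - (if x \<in> Y then b x else 0)) * (x $ i) ^ (d - n) * F x) = 0"
        by (simp add: left_diff_distrib sum_subtractf mult.assoc)
    qed
    with p c i show False by simp
  qed
qed

text \<open>\<open>S\<close> collects the points of \<open>X\<close> at which vanishing has to be
  prescribed: a form of degree n + 1 vanishing on \<open>Y\<close> and \<open>S\<close> turns the
  relation into one on \<open>X - S\<close> in degree \<open>d - n - 1\<close>, where independence
  applies. The summand 2 leaves room for two independent forms.\<close>

lemma equal_if_general_position:
  assumes fin: "finite X" "finite Y" and dist: "proj_distinct (X \<union> Y)"
    and gen: "\<And>X'. X' \<subseteq> X \<Longrightarrow> card X' \<le> card (tri n) \<Longrightarrow> indep_pts n X'"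
    and d: "2 * n + 1 \<le> d" and card: "card Y \<le> card X"
    and c: "\<And>p. p \<in> X \<Longrightarrow> c p \<noteq> 0" and b: "\<And>p. p \<in> Y \<Longrightarrow> b p \<noteq> 0"
    and rel: "\<And>F. F \<in> hforms d \<Longrightarrow> (\<Sum>p\<in>X. c p * F p) = (\<Sum>p\<in>Y. b p * F p)"
    and S: "S \<subseteq> X" "indep_pts (d - n - 1) (X - S)" "card Y + card S + 2 \<le> card (tri (n + 1))"
  shows "X = Y"
proof -
  define W where "W = Y \<union> S"
  have finW: "finite W" using fin S(1) finite_subset by (auto simp: W_def)
  have cW: "card W + 2 \<le> card (tri (n + 1))"
    using card_Un_le[of Y S] S(3) by (simp add: W_def)
  have X_van: "F p = 0" if F: "F \<in> hforms (n + 1)" "\<And>p. p \<in> W \<Longrightarrow> F p = 0" and p: "p \<in> X \<union> Y" for F p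
  proof (cases "p \<in> W")
    case False
    with p have pX: "p \<in> X - S" by (auto simp: W_def)
    have "c p * F p = 0"
    proof (rule indep_ptsD[OF S(2) _ pX])
      fix G assume G: "G \<in> hforms (d - n - 1)"
      have H: "(\<lambda>z. F z * G z) \<in> hforms d" using hforms_mult[OF F(1) G] d by simp
      have "(\<Sum>x\<in>X - S. c x * F x * G x) = (\<Sum>x\<in>X. c x * (F x * G x))"
        using fin(1) F(2) by (intro sum.mono_neutral_cong_left) (auto simp: W_def)
      also have "\<dots> = 0" unfolding rel[OF H] using F(2) by (simp add: W_def)
      finally show "(\<Sum>x\<in>X - S. c x * F x * G x) = 0" .
    qed
    with c pX show ?thesis by simp
  qed (use F in auto)
  have "card W < card (tri (n + 1))" using cW by simp
  then obtain F v where F: "F \<in> hforms (n + 1)" "\<And>x. x \<in> W \<Longrightarrow> F x = 0" "v $ 3 = 1" "F v \<noteq> 0"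
    using hforms_exists_vanishing[OF finW, of "n + 1"] by blast
  \<comment> \<open>Requiring the second form to vanish at \<open>v\<close>, where the first does
    not, makes the two independent.\<close>
  have "card (insert v W) < card (tri (n + 1))" using cW card_insert_le_m1[of "card W + 1" W v] by simp
  then obtain G u where G: "G \<in> hforms (n + 1)" "\<And>x. x \<in> insert v W \<Longrightarrow> G x = 0" "G u \<noteq> 0"
    using hforms_exists_vanishing[of "insert v W" "n + 1"] finW by (metis finite_insert)
  define w where "w p = (if p \<in> X then c p else 0) - (if p \<in> Y then b p else 0)" for p
  have "(\<Sum>p\<in>X\<union>Y. w p * H p) = 0" if "H \<in> hforms d" for H
  proof -
    have "(\<Sum>p\<in>X\<union>Y. (if p \<in> X then c p else 0) * H p) = (\<Sum>p\<in>X. c p * H p)"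
      "(\<Sum>p\<in>X\<union>Y. (if p \<in> Y then b p else 0) * H p) = (\<Sum>p\<in>Y. b p * H p)"
      using fin by (auto intro!: sum.mono_neutral_cong_right)
    with rel[OF that] show ?thesis by (simp add: w_def left_diff_distrib sum_subtractf)
  qed
  then obtain Q u where Q: "Q \<in> hforms n" "Q u \<noteq> 0" "\<And>p. p \<in> X \<union> Y \<Longrightarrow> w p * Q p = 0"
    using weights_supported_on_lower_degree_curve[of "X \<union> Y" F "n + 1" G v u d w] fin dist F G X_van d by auto
  define X1 where "X1 = {p\<in>X. Q p = 0}"
  define Y1 where "Y1 = {p\<in>Y. Q p = 0}"
  have X1: "X1 \<subseteq> X" "finite X1" and Y1: "Y1 \<subseteq> Y" "finite Y1" using fin by (auto simp: X1_def Y1_def)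
  have w0: "w p = 0" if "p \<in> X \<union> Y" "Q p \<noteq> 0" for p using Q(3)[OF that(1)] that(2) by simp
  \<comment> \<open>Off the curve \<open>w\<close> vanishes. A point belonging to just one of the
    sets would have weight \<open>c p\<close> or \<open>- b p\<close>, which is nonzero, so it
    belongs to both, with equal weights.\<close>
  have diff: "X - X1 = Y - Y1"
    using w0 c b unfolding X1_def Y1_def w_def by (fastforce split: if_splits)
  have cb: "c p = b p" if "p \<in> X - X1" for p
    using w0[of p] that diff unfolding w_def X1_def Y1_def by (auto split: if_splits)
  \<comment> \<open>Otherwise \<open>card (tri n)\<close> independent points would lie on the curve
    of degree \<open>n\<close> and force \<open>Q\<close> to be zero.\<close>
  have "card X1 \<le> card (tri n)"
  proof (rule ccontr)
    assume "\<not> ?thesis"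
    then obtain X' where X': "X' \<subseteq> X1" "card X' = card (tri n)"
      using obtain_subset_with_card_n[of "card (tri n)" X1] by auto
    have "Q u = 0"
    proof (rule indep_pts_no_vanishing[OF _ gen _ Q(1)])
      show "finite X'" using X'(1) X1(2) finite_subset by blast
      show "X' \<subseteq> X" using X' X1 by blast
    qed (use X' in \<open>auto simp: X1_def\<close>)
    with Q(2) show False by simp
  qed
  then have "indep_pts n X1" by (rule gen[OF X1(1)])
  moreover have "card Y1 \<le> card X1"
    using diff card card_Diff_subset[OF X1(2,1)] card_Diff_subset[OF Y1(2,1)] card_mono[OF fin(1) X1(1)]
      card_mono[OF fin(2) Y1(1)] by simp
  moreover have "(\<Sum>p\<in>X1. c p * F p) = (\<Sum>p\<in>Y1. b p * F p)" if "F \<in> hforms d" for F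
  proof -
    have "(\<Sum>p\<in>X-X1. c p * F p) = (\<Sum>p\<in>Y-Y1. b p * F p)"
      using cb by (intro sum.cong[OF diff]) (simp add: diff)
    with rel[OF that] show ?thesis
      using sum.subset_diff[OF X1(1) fin(1), of "\<lambda>p. c p * F p"] sum.subset_diff[OF Y1(1) fin(2), of "\<lambda>p. b p * F p"] by simp
  qed
  ultimately have "X1 = Y1"
    using X1 Y1 d c by (intro equal_if_indep_pts[of X1 Y1 n d c b] proj_distinct_subset[OF dist]) auto
  with diff X1(1) Y1(1) show ?thesis by blast
qed

section \<open>Powers of linear forms and projective points\<close>

definition expo :: "nat \<Rightarrow> nat \<times> nat \<Rightarrow> monom3" where
  "expo t e = Poly_Mapping.single 1 (fst e) + Poly_Mapping.single 2 (snd e) + Poly_Mapping.single 3 (t - fst e - snd e)"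

definition linform :: "complex ^ 3 \<Rightarrow> poly3" where
  "linform a = Poly_Mapping.single (Poly_Mapping.single 1 1) (a $ 1)
     + (Poly_Mapping.single (Poly_Mapping.single 2 1) (a $ 2) + Poly_Mapping.single (Poly_Mapping.single 3 1) (a $ 3))"

lemma lookup_expo [simp]:
  "Poly_Mapping.lookup (expo t e) 1 = fst e"
  "Poly_Mapping.lookup (expo t e) 2 = snd e"
  by (simp_all add: expo_def lookup_add lookup_single when_def)

lemma expo_inj: "expo t e = expo t e' \<longleftrightarrow> e = e'"
  by (metis lookup_expo prod_eq_iff)

lemma single_power_3:
  "Poly_Mapping.single (Poly_Mapping.single i 1) c ^ n = (Poly_Mapping.single (Poly_Mapping.single i n) (c ^ n) :: poly3)"
  by (induction n) (simp_all add: mult_single flip: single_add)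

lemma scale3_single: "scale3 c (Poly_Mapping.single e b) = Poly_Mapping.single e (c * b)"
  by (simp add: scale3_def mult_single)

lemma of_nat_mult_single: "of_nat n * (Poly_Mapping.single e b :: poly3) = Poly_Mapping.single e (of_nat n * b)"
  by (simp add: mult_single flip: single_of_nat)

text \<open>The multinomial coefficient, factored as it arises from two nested binomial expansions
  of a power of \<open>linform\<close>.\<close>

definition multinom :: "nat \<Rightarrow> nat \<times> nat \<Rightarrow> nat" where
  "multinom t e = (t choose fst e) * ((t - fst e) choose snd e)"

lemma multinom_nonzero: "e \<in> tri t \<Longrightarrow> multinom t e \<noteq> 0"
  by (cases e) (simp add: multinom_def)

lemma linform_power:
  "linform a ^ t = (\<Sum>e\<in>tri t. Poly_Mapping.single (expo t e) (of_nat (multinom t e) * tmono t e a))"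
proof -
  let ?X = "\<lambda>i. Poly_Mapping.single (Poly_Mapping.single i 1) (a $ i) :: poly3"
  have "linform a ^ t = (\<Sum>i\<le>t. of_nat (t choose i) * ?X 1 ^ i * (?X 2 + ?X 3) ^ (t - i))"
    unfolding linform_def by (rule binomial_ring)
  also have "\<dots> = (\<Sum>i\<le>t. \<Sum>j\<le>t-i. Poly_Mapping.single (expo t (i, j)) (of_nat (multinom t (i, j)) * tmono t (i, j) a))"
  proof (intro sum.cong refl)
    fix i
    have "of_nat (t choose i) * ?X 1 ^ i * (?X 2 + ?X 3) ^ (t - i) =
      (\<Sum>j\<le>t-i. of_nat (t choose i) * ?X 1 ^ i * (of_nat ((t - i) choose j) * ?X 2 ^ j * ?X 3 ^ (t - i - j)))"
      unfolding binomial_ring by (rule sum_distrib_left)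
    also have "\<dots> = (\<Sum>j\<le>t-i. Poly_Mapping.single (expo t (i, j)) (of_nat (multinom t (i, j)) * tmono t (i, j) a))"
      unfolding single_power_3 of_nat_mult_single mult_single
      by (simp add: expo_def multinom_def tmono_def mult_ac add_ac)
    finally show "of_nat (t choose i) * ?X 1 ^ i * (?X 2 + ?X 3) ^ (t - i) = \<dots>" .
  qed
  also have "\<dots> = (\<Sum>e\<in>tri t. Poly_Mapping.single (expo t e) (of_nat (multinom t e) * tmono t e a))"
    unfolding tri_def by (subst sum.Sigma) (auto simp: case_prod_unfold)
  finally show ?thesis .
qed

lemma scale3_sum_linform_power:
  "(\<Sum>p\<in>A. scale3 (c p) (linform (v p) ^ t)) =
     (\<Sum>e\<in>tri t. Poly_Mapping.single (expo t e) (of_nat (multinom t e) * (\<Sum>p\<in>A. c p * tmono t e (v p))))"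
proof -
  have "(\<Sum>p\<in>A. scale3 (c p) (linform (v p) ^ t)) =
      (\<Sum>p\<in>A. \<Sum>e\<in>tri t. Poly_Mapping.single (expo t e) (c p * (of_nat (multinom t e) * tmono t e (v p))))"
    unfolding linform_power poly3.scale_sum_right scale3_single ..
  also have "\<dots> = (\<Sum>e\<in>tri t. \<Sum>p\<in>A. Poly_Mapping.single (expo t e) (c p * (of_nat (multinom t e) * tmono t e (v p))))"
    by (rule sum.swap)
  also have "\<dots> = (\<Sum>e\<in>tri t. Poly_Mapping.single (expo t e) (of_nat (multinom t e) * (\<Sum>p\<in>A. c p * tmono t e (v p))))"
  proof (intro sum.cong refl)
    fix e
    have "(\<Sum>p\<in>A. Poly_Mapping.single (expo t e) (g p)) = Poly_Mapping.single (expo t e) (\<Sum>p\<in>A. g p)"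
      for g :: "'a \<Rightarrow> complex"
      by (induction A rule: infinite_finite_induct) (simp_all add: single_add)
    then show "(\<Sum>p\<in>A. Poly_Mapping.single (expo t e) (c p * (of_nat (multinom t e) * tmono t e (v p)))) =
      Poly_Mapping.single (expo t e) (of_nat (multinom t e) * (\<Sum>p\<in>A. c p * tmono t e (v p)))"
      by (simp add: sum_distrib_left mult_ac)
  qed
  finally show ?thesis .
qed

lemma hforms_sum_tmono:
  assumes "F \<in> hforms t"
  obtains f where "\<And>A c (v :: 'a \<Rightarrow> complex ^ 3). (\<Sum>p\<in>A. c p * F (v p)) = (\<Sum>e\<in>tri t. f e * (\<Sum>p\<in>A. c p * tmono t e (v p)))"
proof -
  obtain f where f: "\<And>p. F p = (\<Sum>e\<in>tri t. f e * tmono t e p)" using hforms_expand[OF assms] by blast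
  have "(\<Sum>p\<in>A. c p * F (v p)) = (\<Sum>e\<in>tri t. f e * (\<Sum>p\<in>A. c p * tmono t e (v p)))"
    for A c and v :: "'a \<Rightarrow> complex ^ 3"
    unfolding f sum_distrib_left by (subst sum.swap) (simp add: mult_ac)
  with that show ?thesis by blast
qed

text \<open>Apolarity: the coefficients of the sum of powers are the weighted sums of monomial
  values, up to multinomial factors, which are nonzero in characteristic zero.\<close>

lemma linform_power_relation_iff:
  "(\<Sum>p\<in>A. scale3 (c p) (linform (v p) ^ t)) = 0 \<longleftrightarrow> (\<forall>F\<in>hforms t. (\<Sum>p\<in>A. c p * F (v p)) = 0)"
proof
  assume 0: "(\<Sum>p\<in>A. scale3 (c p) (linform (v p) ^ t)) = 0"
  have tm: "(\<Sum>p\<in>A. c p * tmono t e (v p)) = 0" if e: "e \<in> tri t" for e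
  proof -
    have "0 = Poly_Mapping.lookup (\<Sum>e\<in>tri t. Poly_Mapping.single (expo t e) (of_nat (multinom t e) * (\<Sum>p\<in>A. c p * tmono t e (v p)))) (expo t e)"
      using 0 unfolding scale3_sum_linform_power by simp
    also have "\<dots> = (\<Sum>e'\<in>tri t. if e' = e then of_nat (multinom t e) * (\<Sum>p\<in>A. c p * tmono t e (v p)) else 0)"
      unfolding lookup_sum lookup_single by (intro sum.cong refl) (auto simp: when_def expo_inj)
    also have "\<dots> = of_nat (multinom t e) * (\<Sum>p\<in>A. c p * tmono t e (v p))" using e by simp
    finally show ?thesis using multinom_nonzero[OF e] by simp
  qed
  show "\<forall>F\<in>hforms t. (\<Sum>p\<in>A. c p * F (v p)) = 0"
  proof
    fix F assume "F \<in> hforms t"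
    then obtain f where "\<And>A c (v :: 'a \<Rightarrow> complex ^ 3). (\<Sum>p\<in>A. c p * F (v p)) = (\<Sum>e\<in>tri t. f e * (\<Sum>p\<in>A. c p * tmono t e (v p)))"
      using hforms_sum_tmono by blast
    with tm show "(\<Sum>p\<in>A. c p * F (v p)) = 0" by simp
  qed
next
  assume "\<forall>F\<in>hforms t. (\<Sum>p\<in>A. c p * F (v p)) = 0"
  then show "(\<Sum>p\<in>A. scale3 (c p) (linform (v p) ^ t)) = 0"
    unfolding scale3_sum_linform_power by (intro sum.neutral) (simp add: hforms_tmono)
qed

lemma forms_1_linform:
  assumes "F \<in> forms 1"
  shows "F = linform (\<chi> i. Poly_Mapping.lookup F (Poly_Mapping.single i 1))"
proof (rule poly_mapping_eqI)
  fix e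
  show "Poly_Mapping.lookup F e = Poly_Mapping.lookup (linform (\<chi> i. Poly_Mapping.lookup F (Poly_Mapping.single i 1))) e"
  proof (cases "\<exists>i. e = Poly_Mapping.single i 1")
    case True
    then obtain i where i: "e = Poly_Mapping.single i 1" by blast
    have "(Poly_Mapping.single i (1::nat) = Poly_Mapping.single j 1) \<longleftrightarrow> i = j" for i j :: 3
      by (metis lookup_single_eq lookup_single_not_eq zero_neq_one)
    then show ?thesis using exhaust_3[of i] unfolding i linform_def
      by (auto simp: lookup_add lookup_single when_def)
  next
    case False
    have "e \<notin> Poly_Mapping.keys F"
    proof
      assume "e \<in> Poly_Mapping.keys F"
      with assms have s: "Poly_Mapping.lookup e 1 + Poly_Mapping.lookup e 2 + Poly_Mapping.lookup e 3 = 1"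
        by (auto simp: forms_def sum_3)
      have "\<exists>i. \<forall>k. Poly_Mapping.lookup e k = Poly_Mapping.lookup (Poly_Mapping.single i 1) k"
      proof -
        consider "Poly_Mapping.lookup e 1 = 1" | "Poly_Mapping.lookup e 2 = 1" | "Poly_Mapping.lookup e 3 = 1"
          using s by linarith
        then show ?thesis
        proof cases
            case 1
            then show ?thesis using s by (intro exI[of _ 1]) (simp add: forall_3 lookup_single when_def)
          next
            case 2
            then show ?thesis using s by (intro exI[of _ 2]) (simp add: forall_3 lookup_single when_def)
          next
            case 3
            then show ?thesis using s by (intro exI[of _ 3]) (simp add: forall_3 lookup_single when_def)
          qed
      qed
      with False show False by (metis poly_mapping_eqI)
    qed
    then have "Poly_Mapping.lookup F e = 0" by (simp add: in_keys_iff)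
    moreover have "Poly_Mapping.lookup (linform (\<chi> i. Poly_Mapping.lookup F (Poly_Mapping.single i 1))) e = 0"
    proof -
      have "Poly_Mapping.single i 1 \<noteq> e" for i using False by blast
      then show ?thesis unfolding linform_def lookup_add lookup_single when_def by simp
    qed
    ultimately show ?thesis by simp
  qed
qed

lemma scale3_linform: "scale3 a (linform v) = linform (a *s v)"
  by (simp add: linform_def poly3.scale_right_distrib scale3_single)

lemma linform_zero: "linform 0 = 0"
  by (simp add: linform_def)

lemma pclass_scale3:
  assumes "a \<noteq> 0"
  shows "pclass (scale3 a L) = pclass L"
  unfolding pclass_def
proof (intro antisym poly3.span_minimal poly3.subspace_span)
  show "{scale3 a L} \<subseteq> poly3.span {L}" by (simp add: poly3.span_base poly3.span_scale)
  have "scale3 (inverse a) (scale3 a L) \<in> poly3.span {scale3 a L}"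
    by (intro poly3.span_scale poly3.span_base) simp
  then show "{L} \<subseteq> poly3.span {scale3 a L}" using assms by simp
qed

section \<open>Coordinate vectors of projective points\<close>

lemma P2_coords:
  assumes "p \<in> P2"
  shows "p = pclass (linform (coords p))" and "coords p \<noteq> 0"
proof -
  obtain M where M: "M \<in> forms 1" "M \<noteq> 0" "p = pclass M" using assms by (auto simp: proj_def)
  define L where "L = (SOME L. L \<in> p \<and> L \<noteq> 0)"
  have "M \<in> p \<and> M \<noteq> 0" using M by (simp add: pclass_def poly3.span_base)
  then have L: "L \<in> p" "L \<noteq> 0" unfolding L_def by (metis (mono_tags, lifting) someI_ex)+
  then obtain k where k: "L = scale3 k M" using M(3) by (auto simp: pclass_def poly3.span_singleton)
  with L have k0: "k \<noteq> 0" by auto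
  have lm: "M = linform (\<chi> i. Poly_Mapping.lookup M (Poly_Mapping.single i 1))" by (rule forms_1_linform[OF M(1)])
  have "Poly_Mapping.keys L \<subseteq> Poly_Mapping.keys M"
  proof
    fix e assume "e \<in> Poly_Mapping.keys L"
    then show "e \<in> Poly_Mapping.keys M" unfolding k scale3_def
      using Poly_Mapping.keys_mult[of "Poly_Mapping.single 0 k" M] by (auto split: if_splits)
  qed
  then have "L \<in> forms 1" using M(1) by (auto simp: forms_def)
  then have lL: "L = linform (coords p)"
    unfolding coords_def L_def[symmetric] Let_def by (rule forms_1_linform)
  then show "coords p \<noteq> 0" using L(2) linform_zero by metis
  show "p = pclass (linform (coords p))" using M(3) lL pclass_scale3[OF k0, of M] k by simp
qed

lemma inj_on_coords: "inj_on coords P2"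
  by (metis P2_coords(1) inj_onI)

lemma proj_distinct_coords:
  assumes "A \<subseteq> P2"
  shows "proj_distinct (coords ` A)"
proof -
  have "coords p = coords q" if "p \<in> A" "q \<in> A" "coords p = a *s coords q" for p q a
  proof -
    have a0: "a \<noteq> 0" using P2_coords(2)[of p] that assms by auto
    have "p = q" using P2_coords(1)[of p] P2_coords(1)[of q] that assms
        pclass_scale3[OF a0, of "linform (coords q)"] by (auto simp: scale3_linform)
    then show ?thesis by simp
  qed
  moreover have "coords p \<noteq> 0" if "p \<in> A" for p using P2_coords(2) that assms by blast
  ultimately show ?thesis unfolding proj_distinct_def by fastforce
qed

lemma span_veronese:
  assumes "A \<subseteq> P2"
  shows "poly3.span (\<Union>(veronese d ` A)) = poly3.span ((\<lambda>p. linform (coords p) ^ d) ` A)"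
proof -
  have v: "veronese d p = poly3.span {linform (coords p) ^ d}" if "p \<in> A" for p
    using veronese_pclass[of d "linform (coords p)"] P2_coords(1)[of p] assms that by (auto simp: pclass_def)
  show ?thesis
  proof (intro antisym poly3.span_minimal poly3.subspace_span)
    show "\<Union>(veronese d ` A) \<subseteq> poly3.span ((\<lambda>p. linform (coords p) ^ d) ` A)"
    proof (rule Union_least)
      fix S assume "S \<in> veronese d ` A"
      then obtain p where p: "p \<in> A" "S = veronese d p" by blast
      then show "S \<subseteq> poly3.span ((\<lambda>p. linform (coords p) ^ d) ` A)"
        unfolding v[OF p(1)] p(2) by (intro poly3.span_mono) auto
    qed
    show "(\<lambda>p. linform (coords p) ^ d) ` A \<subseteq> poly3.span (\<Union>(veronese d ` A))"
    proof (rule image_subsetI)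
      fix p assume p: "p \<in> A"
      then have "linform (coords p) ^ d \<in> veronese d p" unfolding v[OF p] by (intro poly3.span_base) simp
      with p show "linform (coords p) ^ d \<in> poly3.span (\<Union>(veronese d ` A))"
        by (intro poly3.span_base) blast
    qed
  qed
qed

section \<open>From Kruskal rank and Hilbert function to independent conditions\<close>

lemma span_image_expand:
  assumes "finite A" "x \<in> poly3.span (f ` A)"
  obtains c where "x = (\<Sum>a\<in>A. scale3 (c a) (f a))"
proof -
  have "\<exists>c. x = (\<Sum>a\<in>A. scale3 (c a) (f a))"
    using assms
  proof (induction A arbitrary: x rule: finite_induct)
    case (insert a A)
    then obtain k where "x - scale3 k (f a) \<in> poly3.span (f ` A)" by (auto simp: poly3.span_insert)
    with insert.IH obtain c where c: "x - scale3 k (f a) = (\<Sum>a\<in>A. scale3 (c a) (f a))" by blast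
    have "(\<Sum>b\<in>A. scale3 ((c(a := k)) b) (f b)) = (\<Sum>b\<in>A. scale3 (c b) (f b))"
      using insert.hyps by (intro sum.cong) auto
    with c insert.hyps show ?case by (intro exI[of _ "c(a := k)"]) (simp add: algebra_simps)
  qed simp
  with that show ?thesis by blast
qed

text \<open>A nontrivial relation would let fewer than \<open>card A\<close> vectors span.
  Coefficients are indexed by \<open>A\<close>, not by its image, so coinciding vectors also count
  as dependent.\<close>

lemma independent_if_dim_span_image:
  assumes A: "finite A" and dim: "poly3.dim (poly3.span (f ` A)) = card A"
    and c: "(\<Sum>a\<in>A. scale3 (c a) (f a)) = 0" and p: "p \<in> A"
  shows "c p = 0"
proof (rule ccontr)
  assume cp: "c p \<noteq> 0"
  let ?B = "f ` (A - {p})"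
  have "scale3 (c p) (f p) = - (\<Sum>a\<in>A-{p}. scale3 (c a) (f a))"
    using c sum.remove[OF A p, of "\<lambda>a. scale3 (c a) (f a)"] by (simp add: eq_neg_iff_add_eq_0)
  also have "\<dots> \<in> poly3.span ?B"
    by (intro poly3.span_neg poly3.span_sum poly3.span_scale poly3.span_base) auto
  finally have "scale3 (inverse (c p)) (scale3 (c p) (f p)) \<in> poly3.span ?B" by (rule poly3.span_scale)
  then have "f p \<in> poly3.span ?B" using cp by simp
  then have "poly3.span (f ` A) \<subseteq> poly3.span ?B"
    by (intro poly3.span_minimal poly3.subspace_span) (auto intro: poly3.span_base)
  then have "poly3.dim (poly3.span (f ` A)) \<le> card ?B" using A by (intro poly3.dim_le_card) auto
  also have "\<dots> \<le> card (A - {p})" using A by (intro card_image_le) auto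
  also have "\<dots> < card A" using A p by (rule card_Diff1_less)
  finally show False using dim by simp
qed

lemma indep_pts_coordsI:
  assumes A: "A \<subseteq> P2" and *: "\<And>c p. (\<And>F. F \<in> hforms n \<Longrightarrow> (\<Sum>p\<in>A. c p * F (coords p)) = 0) \<Longrightarrow> p \<in> A \<Longrightarrow> c p = 0"
  shows "indep_pts n (coords ` A)"
  unfolding indep_pts_def
proof (intro allI impI ballI)
  fix c x assume c: "\<forall>F\<in>hforms n. (\<Sum>x\<in>coords ` A. c x * F x) = 0" and x: "x \<in> coords ` A"
  from x obtain p where p: "p \<in> A" "x = coords p" by blast
  have "inj_on coords A" using inj_on_coords A inj_on_subset by blast
  with c have "(\<Sum>p\<in>A. c (coords p) * F (coords p)) = 0" if "F \<in> hforms n" for F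
    using that by (auto simp: sum.reindex)
  from *[of "\<lambda>p. c (coords p)", OF this p(1)] p(2) show "c x = 0" by simp
qed

lemma kruskal_rank_indep_pts:
  assumes A: "finite A" "A \<subseteq> P2" and A': "A' \<subseteq> A" "card A' \<le> kruskal_rank j A"
  shows "indep_pts j (coords ` A')"
proof -
  let ?S = "{k. k \<le> card A \<and> (\<forall>A'. A' \<subseteq> A \<and> card A' \<le> k \<longrightarrow> pspan_dim (veronese j ` A') = int (card A') - 1)}"
  have "finite ?S" by (rule finite_subset[of _ "{..card A}"]) auto
  \<comment> \<open>The empty subset puts 0 into the set, so the maximum is attained.\<close>
  moreover have "pspan_dim (veronese j ` A') = int (card A') - 1" if "A' \<subseteq> A" "card A' \<le> 0" for A'
  proof -
    have "A' = {}" using that A(1) finite_subset by fastforce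
    then show ?thesis
      using poly3.dim_span_eq_card_independent[OF poly3.independent_empty] by (simp add: pspan_dim_def)
  qed
  then have "0 \<in> ?S" by simp
  then have "?S \<noteq> {}" by blast
  ultimately have "kruskal_rank j A \<in> ?S" unfolding kruskal_rank_def by (rule Max_in)
  with A' have dim: "pspan_dim (veronese j ` A') = int (card A') - 1" by blast
  have A'P: "A' \<subseteq> P2" "finite A'" using A A' finite_subset by auto
  have dim: "poly3.dim (poly3.span ((\<lambda>p. linform (coords p) ^ j) ` A')) = card A'"
    using dim unfolding pspan_dim_def span_veronese[OF A'P(1)] by simp
  show ?thesis
  proof (rule indep_pts_coordsI[OF A'P(1)])
    fix c p assume "\<And>F. F \<in> hforms j \<Longrightarrow> (\<Sum>p\<in>A'. c p * F (coords p)) = 0" "p \<in> A'"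
    then show "c p = 0"
      using linform_power_relation_iff[where A = A' and c = c and v = coords and t = j]
      by (intro independent_if_dim_span_image[OF A'P(2) dim, of c]) auto
  qed
qed

lemma prod_UNIV_3: "(\<Prod>i\<in>UNIV. f i) = f 1 * f 2 * f (3 :: 3)" for f :: "3 \<Rightarrow> complex"
  unfolding UNIV_3 by (simp add: ac_simps)

lemma eval3_hforms:
  assumes "F \<in> forms m"
  shows "eval3 F \<in> hforms m"
proof -
  have "(\<lambda>a. Poly_Mapping.lookup F e * (\<Prod>i\<in>UNIV. (a $ i) ^ Poly_Mapping.lookup e i)) \<in> hforms m"
    if "e \<in> Poly_Mapping.keys F" for e
  proof -
    have s: "Poly_Mapping.lookup e 1 + Poly_Mapping.lookup e 2 + Poly_Mapping.lookup e 3 = m"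
      using assms that by (auto simp: forms_def sum_3)
    define t where "t = (Poly_Mapping.lookup e 1, Poly_Mapping.lookup e 2)"
    have "m - Poly_Mapping.lookup e 1 - Poly_Mapping.lookup e 2 = Poly_Mapping.lookup e 3" using s by simp
    then have eq: "(\<Prod>i\<in>UNIV. (a $ i) ^ Poly_Mapping.lookup e i) = tmono m t a" for a
      unfolding tmono_def t_def prod_UNIV_3 fst_conv snd_conv by (simp only:)
    have "t \<in> tri m" using s by (simp add: t_def)
    then show ?thesis unfolding eq by (intro hforms_scale hforms_tmono)
  qed
  then show ?thesis unfolding eval3_def[abs_def] by (rule hforms_sum)
qed

text \<open>A relation with nonzero weight at \<open>p\<close> determines each value at
  \<open>p\<close> from the other values, so the image of evaluation has dimension below
  \<open>card A\<close>.\<close>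

lemma hilb_indep_pts:
  assumes A: "finite A" "A \<subseteq> P2" and h: "hilb A (int m) = card A"
  shows "indep_pts m (coords ` A)"
proof (rule indep_pts_coordsI[OF A(2)], rule ccontr)
  fix c p assume kill: "\<And>F. F \<in> hforms m \<Longrightarrow> (\<Sum>p\<in>A. c p * F (coords p)) = 0" and p: "p \<in> A" "c p \<noteq> 0"
  \<comment> \<open>These vectors span the hyperplane of value vectors satisfying the relation: free
    values off \<open>p\<close>, with the entry at \<open>p\<close> solved for.\<close>
  define \<delta> where "\<delta> q = (\<lambda>x. if x = q then 1 else if x = p then - c q / c p else 0)" for q
  have "eval_at A ` forms m \<subseteq> cfun.span (\<delta> ` (A - {p}))"
  proof
    fix f assume "f \<in> eval_at A ` forms m"
    then obtain F where F: "F \<in> forms m" "f = eval_at A F" by blast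
    have "f = (\<Sum>q\<in>A-{p}. (\<lambda>x. f q * \<delta> q x))"
    proof
      fix x
      have "(\<Sum>q\<in>A-{p}. (\<lambda>x. f q * \<delta> q x)) x = (\<Sum>q\<in>A-{p}. f q * \<delta> q x)"
      proof -
        have "(\<Sum>q\<in>S. g q) x = (\<Sum>q\<in>S. g q x)" for S and g :: "poly3 set \<Rightarrow> poly3 set \<Rightarrow> complex"
          by (induction S rule: infinite_finite_induct) simp_all
        then show ?thesis .
      qed
      also have "\<dots> = f x"
      proof (cases "x = p")
        case True
        have "0 = c p * f p + (\<Sum>q\<in>A-{p}. c q * f q)"
          using kill[OF eval3_hforms[OF F(1)]] p(1) sum.remove[OF A(1) p(1), of "\<lambda>q. c q * f q"]
          by (simp add: F(2) eval_at_def)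
        then have "f p = (\<Sum>q\<in>A-{p}. c q * f q) / - c p" using p(2) by (simp add: field_simps add_eq_0_iff)
        also have "\<dots> = (\<Sum>q\<in>A-{p}. f q * \<delta> q p)"
          unfolding sum_divide_distrib by (intro sum.cong) (auto simp: \<delta>_def)
        finally show ?thesis using True by simp
      next
        case False
        then have "(\<Sum>q\<in>A-{p}. f q * \<delta> q x) = (\<Sum>q\<in>A-{p}. if q = x then f x else 0)"
          by (intro sum.cong) (auto simp: \<delta>_def)
        also have "\<dots> = f x" using False A(1) by (auto simp: F(2) eval_at_def)
        finally show ?thesis .
      qed
      finally show "f x = (\<Sum>q\<in>A-{p}. (\<lambda>x. f q * \<delta> q x)) x" by simp
    qed
    moreover have "(\<Sum>q\<in>A-{p}. (\<lambda>x. f q * \<delta> q x)) \<in> cfun.span (\<delta> ` (A - {p}))"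
      by (intro cfun.span_sum cfun.span_scale cfun.span_base imageI)
    ultimately show "f \<in> cfun.span (\<delta> ` (A - {p}))" by (simp only:)
  qed
  then have "cfun.dim (eval_at A ` forms m) \<le> card (\<delta> ` (A - {p}))"
    using A(1) by (intro cfun.dim_le_card) auto
  also have "\<dots> \<le> card (A - {p})" using A(1) by (intro card_image_le) auto
  also have "\<dots> < card A" using A(1) p(1) by (rule card_Diff1_less)
  finally show False using h by (simp add: hilb_def)
qed

section \<open>Identifiability\<close>

lemma computes_expand:
  assumes "computes d A T"
  obtains t c where "t \<noteq> 0" "T = pclass t" "t = (\<Sum>p\<in>A. scale3 (c p) (linform (coords p) ^ d))"
proof -
  from assms have A: "finite A" "A \<subseteq> P2" and "T \<in> pspan (veronese d ` A)" by (auto simp: computes_def)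
  then obtain t where t: "t \<noteq> 0" "T = pclass t" "t \<in> poly3.span ((\<lambda>p. linform (coords p) ^ d) ` A)"
    unfolding pspan_def span_veronese[OF A(2)] by (auto simp: proj_def)
  with span_image_expand[OF A(1) t(3)] that show ?thesis by blast
qed

lemma non_redundant_coeff_nonzero:
  assumes A: "finite A" "A \<subseteq> P2" and nr: "non_redundant d A (pclass t)"
    and t: "t \<noteq> 0" "t = (\<Sum>p\<in>A. scale3 (c p) (linform (coords p) ^ d))" and p: "p \<in> A"
  shows "c p \<noteq> 0"
proof
  assume "c p = 0"
  moreover have "t = scale3 (c p) (linform (coords p) ^ d) + (\<Sum>q\<in>A-{p}. scale3 (c q) (linform (coords q) ^ d))"
    unfolding t(2) by (rule sum.remove[OF A(1) p])
  ultimately have "t = (\<Sum>q\<in>A-{p}. scale3 (c q) (linform (coords q) ^ d))" by simp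
  also have "\<dots> \<in> poly3.span ((\<lambda>q. linform (coords q) ^ d) ` (A - {p}))"
    by (intro poly3.span_sum poly3.span_scale poly3.span_base) auto
  also have "\<dots> = poly3.span (\<Union>(veronese d ` (A - {p})))"
    using A(2) by (intro span_veronese[symmetric]) auto
  finally have "pclass t \<in> pspan (veronese d ` (A - {p}))"
    using t(1) by (auto simp: pspan_def proj_def)
  with nr p show False unfolding non_redundant_def by blast
qed

theorem theorem3p1:
  fixes d r :: nat and T :: "poly3 set" and A :: "poly3 set set"
  assumes "T \<in> proj (forms d)"
    and "computes d A T"
    and "non_redundant d A T"
    and "r = card A"
    and "(\<exists>m::nat. d = 2 * m
            \<and> kruskal_rank (m - 1) A = min ((m + 1) choose 2) r
            \<and> hilb A (int m) = r
            \<and> int r \<le> int ((m + 2) choose 2) - 2)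
       \<or> (\<exists>m::nat. d = 2 * m + 1
            \<and> kruskal_rank m A = min ((m + 2) choose 2) r
            \<and> hilb A (int m + 1) = r
            \<and> r \<le> ((m + 2) choose 2) + m div 2)"
  shows "form_rank d T = r \<and> identifiable d T"
proof -
  have A: "finite A" "A \<subseteq> P2" using assms(2) by (auto simp: computes_def)
  have inj: "inj_on coords A" using inj_on_coords A(2) inj_on_subset by blast
  define X where "X = coords ` A"
  have X: "finite X" "card X = r" using A inj assms(4) by (auto simp: X_def card_image)
  \<comment> \<open>This merges the two parities: all that remains of the case distinction is
    \<open>n\<close> and, when \<open>X\<close> exceeds the dimension of the forms of degree
    \<open>n\<close>, the set \<open>S\<close>.\<close>
  obtain n where n: "2 * n + 1 \<le> d" "kruskal_rank n A = min (card (tri n)) r"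
    and big: "card (tri n) < r \<Longrightarrow>
      \<exists>S\<subseteq>X. indep_pts (d - n - 1) (X - S) \<and> r + card S + 2 \<le> card (tri (n + 1))"
    using assms(5)
  proof (elim disjE exE conjE)
    fix m assume m: "d = 2 * m" "kruskal_rank (m - 1) A = min ((m + 1) choose 2) r"
      "hilb A (int m) = r" "int r \<le> int ((m + 2) choose 2) - 2"
    \<comment> \<open>For m = 0 the integer bound would be -1; hence \<open>m - 1\<close> is not
      truncated.\<close>
    from m(4) have m1: "m \<ge> 1" by (cases m) (simp_all add: numeral_2_eq_2)
    show ?thesis
    proof (rule that[of "m - 1"])
      show "2 * (m - 1) + 1 \<le> d" using m(1) m1 by simp
      show "kruskal_rank (m - 1) A = min (card (tri (m - 1))) r"
        using m(2) m1 by (simp add: card_tri)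
      have "indep_pts m X" unfolding X_def by (rule hilb_indep_pts[OF A]) (simp add: m(3) assms(4))
      moreover have "d - (m - 1) - 1 = m" using m(1) m1 by simp
      moreover have "r + 2 \<le> card (tri (m - 1 + 1))" using m(4) m1 by (simp add: card_tri)
      ultimately show "\<exists>S\<subseteq>X. indep_pts (d - (m - 1) - 1) (X - S) \<and> r + card S + 2 \<le> card (tri (m - 1 + 1))"
        by (intro exI[of _ "{}"]) simp
    qed
  next
    fix m assume m: "d = 2 * m + 1" "kruskal_rank m A = min ((m + 2) choose 2) r"
      "r \<le> ((m + 2) choose 2) + m div 2"
    show ?thesis
    proof (rule that[of m])
      show "2 * m + 1 \<le> d" "kruskal_rank m A = min (card (tri m)) r"
        using m by (simp_all add: card_tri)
      assume r: "card (tri m) < r"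
      then obtain A' where A': "A' \<subseteq> A" "card A' = card (tri m)"
        using obtain_subset_with_card_n[of "card (tri m)" A] assms(4) by auto
      \<comment> \<open>Removing \<open>?S\<close> leaves as many points as the Kruskal rank
        controls, and they are independent in degree \<open>d - m - 1\<close>, which is
        \<open>m\<close> again.\<close>
      let ?S = "X - coords ` A'"
      have sub: "coords ` A' \<subseteq> X" using A' by (auto simp: X_def)
      have "card (coords ` A') = card (tri m)" using A' inj by (metis card_image inj_on_subset)
      then have "card ?S = r - card (tri m)"
        using card_Diff_subset[of "coords ` A'" X] sub X finite_subset by metis
      moreover have "card (tri (m + 1)) = card (tri m) + m + 2"
        unfolding card_tri by (simp add: numeral_2_eq_2)
      ultimately have "r + card ?S + 2 \<le> card (tri (m + 1))"
        using m(3) r unfolding card_tri by simp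
      moreover have "X - ?S = coords ` A'" using sub by blast
      moreover have "indep_pts m (coords ` A')"
        using kruskal_rank_indep_pts[OF A A'(1), of m] m(2) r A'(2) by (simp add: card_tri)
      moreover have "d - m - 1 = m" using m(1) by simp
      ultimately show "\<exists>S\<subseteq>X. indep_pts (d - m - 1) (X - S) \<and> r + card S + 2 \<le> card (tri (m + 1))"
        by (intro exI[of _ ?S]) auto
    qed
  qed
  have gen: "indep_pts n X'" if X': "X' \<subseteq> X" "card X' \<le> card (tri n)" for X'
  proof -
    obtain A' where A': "A' \<subseteq> A" "X' = coords ` A'" using X'(1) unfolding X_def by (metis subset_imageE)
    then have "card X' = card A'" using inj by (metis card_image inj_on_subset)
    moreover have "card A' \<le> r" using A'(1) A(1) assms(4) by (simp add: card_mono)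
    ultimately show ?thesis using kruskal_rank_indep_pts[OF A A'(1), of n] A'(2) X'(2) n(2) by simp
  qed
  obtain t c where t: "t \<noteq> 0" "T = pclass t" and tc: "t = (\<Sum>p\<in>A. scale3 (c p) (linform (coords p) ^ d))"
    by (rule computes_expand[OF assms(2)])
  have c: "c p \<noteq> 0" if "p \<in> A" for p
    using non_redundant_coeff_nonzero[OF A _ t(1) tc that] assms(3) t(2) by simp
  \<comment> \<open>\<open>B\<close> need not be non-redundant, so that this one statement yields
    both the rank and uniqueness.\<close>
  have uniq: "B = A" if comp: "computes d B T" and card: "card B \<le> r" for B
  proof -
    have B: "finite B" "B \<subseteq> P2" using comp by (auto simp: computes_def)
    obtain t' b' where t': "T = pclass t'" "t' = (\<Sum>p\<in>B. scale3 (b' p) (linform (coords p) ^ d))"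
      using computes_expand[OF comp] by blast
    have "t \<in> pclass t'" using t(2) t'(1) poly3.span_base[of t "{t}"] by (simp add: pclass_def)
    then obtain k where k: "t = scale3 k t'" by (auto simp: pclass_def poly3.span_singleton)
    define b where "b p = k * b' p" for p
    \<comment> \<open>Points of zero weight are dropped, because the comparison off the curve
      requires nonzero weights on both sides.\<close>
    define B' where "B' = {p\<in>B. b p \<noteq> 0}"
    have B': "finite B'" "B' \<subseteq> B" "B' \<subseteq> P2" using B by (auto simp: B'_def)
    have "t = (\<Sum>p\<in>B. scale3 (b p) (linform (coords p) ^ d))"
      unfolding k t'(2) b_def poly3.scale_sum_right by simp
    also have "\<dots> = (\<Sum>p\<in>B'. scale3 (b p) (linform (coords p) ^ d))"
      using B(1) by (intro sum.mono_neutral_right) (auto simp: B'_def)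
    finally have tb: "t = (\<Sum>p\<in>B'. scale3 (b p) (linform (coords p) ^ d))" .
    define Y where "Y = coords ` B'"
    have injB: "inj_on coords B'" using inj_on_coords B'(3) inj_on_subset by blast
    have cardB': "card B' \<le> r" using card_mono[OF B(1) B'(2)] card by simp
    then have Y: "finite Y" "card Y \<le> card X" using B' injB X by (auto simp: Y_def card_image)
    \<comment> \<open>The inverse of \<open>coords\<close> on the plane; it carries weights on
      points over to weights on vectors.\<close>
    define pt where "pt v = pclass (linform v)" for v
    have pt: "pt (coords p) = p" if "p \<in> P2" for p using P2_coords(1)[OF that] by (simp add: pt_def)
    define w where "w p = (if p \<in> A then c p else 0) - (if p \<in> B' then b p else 0)" for p
    have split: "(\<Sum>p\<in>A\<union>B'. (if p \<in> A then g p else 0)) = (\<Sum>p\<in>A. g p)"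
      "(\<Sum>p\<in>A\<union>B'. (if p \<in> B' then g p else 0)) = (\<Sum>p\<in>B'. g p)" for g :: "poly3 set \<Rightarrow> 'x :: comm_monoid_add"
      using A(1) B'(1) by (auto intro!: sum.mono_neutral_cong_right)
    have "(\<Sum>p\<in>A\<union>B'. scale3 (w p) (linform (coords p) ^ d)) = t - t"
    proof -
      have "scale3 (w p) (linform (coords p) ^ d) =
        (if p \<in> A then scale3 (c p) (linform (coords p) ^ d) else 0) -
        (if p \<in> B' then scale3 (b p) (linform (coords p) ^ d) else 0)" for p
        by (simp add: w_def poly3.scale_left_diff_distrib)
      then have "(\<Sum>p\<in>A\<union>B'. scale3 (w p) (linform (coords p) ^ d)) =
        (\<Sum>p\<in>A. scale3 (c p) (linform (coords p) ^ d)) - (\<Sum>p\<in>B'. scale3 (b p) (linform (coords p) ^ d))"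
        by (simp only: sum_subtractf split)
      with tc tb show ?thesis by simp
    qed
    then have "\<forall>F\<in>hforms d. (\<Sum>p\<in>A\<union>B'. w p * F (coords p)) = 0"
      unfolding linform_power_relation_iff[symmetric] by simp
    moreover have "(\<Sum>p\<in>A\<union>B'. w p * F (coords p)) = (\<Sum>p\<in>A. c p * F (coords p)) - (\<Sum>p\<in>B'. b p * F (coords p))" for F
    proof -
      have "w p * F (coords p) = (if p \<in> A then c p * F (coords p) else 0) - (if p \<in> B' then b p * F (coords p) else 0)" for p
        by (simp add: w_def left_diff_distrib)
      then show ?thesis by (simp only: sum_subtractf split)
    qed
    ultimately have "(\<Sum>p\<in>A. c p * F (coords p)) = (\<Sum>p\<in>B'. b p * F (coords p))" if "F \<in> hforms d" for F
      using that by simp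
    moreover have "(\<Sum>x\<in>X. c (pt x) * F x) = (\<Sum>p\<in>A. c p * F (coords p))"
      "(\<Sum>x\<in>Y. b (pt x) * F x) = (\<Sum>p\<in>B'. b p * F (coords p))" for F
      using A(2) B'(3) pt unfolding X_def Y_def sum.reindex[OF inj] sum.reindex[OF injB]
      by (auto intro!: sum.cong)
    ultimately have rel: "(\<Sum>x\<in>X. c (pt x) * F x) = (\<Sum>x\<in>Y. b (pt x) * F x)" if "F \<in> hforms d" for F
      using that by simp
    have cX: "c (pt x) \<noteq> 0" if "x \<in> X" for x using that c pt A(2) by (auto simp: X_def)
    have bY: "b (pt x) \<noteq> 0" if "x \<in> Y" for x using that pt B'(3) by (auto simp: Y_def B'_def)
    have dist: "proj_distinct (X \<union> Y)"
      unfolding X_def Y_def image_Un[symmetric] using A(2) B'(3) by (intro proj_distinct_coords) simp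
    have "X = Y"
    proof (cases "r \<le> card (tri n)")
      case True
      then have "indep_pts n X" using gen[of X] X(2) by simp
      then show ?thesis
        by (rule equal_if_indep_pts[OF X(1) Y(1) dist _ n(1) Y(2) cX rel])
    next
      case False
      then obtain S where S: "S \<subseteq> X" "indep_pts (d - n - 1) (X - S)" "r + card S + 2 \<le> card (tri (n + 1))"
        using big by auto
      have S3: "card Y + card S + 2 \<le> card (tri (n + 1))" using S(3) Y(2) X(2) by simp
      show ?thesis
        by (rule equal_if_general_position[OF X(1) Y(1) dist gen n(1) Y(2) cX bY rel S(1,2) S3])
    qed
    then have "A = B'" using inj_on_image_eq_iff[OF inj_on_coords A(2) B'(3)] by (simp add: X_def Y_def)
    \<comment> \<open>Only the part \<open>B'\<close> was compared with \<open>A\<close>; as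
      \<open>B\<close> has at most \<open>card A\<close> points, none were dropped.\<close>
    then show "B = A" using card assms(4) B(1) B'(2) by (metis card_seteq)
  qed
  have rank: "form_rank d T = r"
    unfolding form_rank_def
  proof (rule Least_equality)
    show "\<exists>A. computes d A T \<and> card A = r" using assms(2,4) by blast
    \<comment> \<open>A computing set with at most \<open>r\<close> points is \<open>A\<close>
      itself, so none has fewer.\<close>
    show "r \<le> k" if "\<exists>B. computes d B T \<and> card B = k" for k
      using that uniq assms(4) by (metis nat_le_linear)
  qed
  moreover have "identifiable d T"
    unfolding identifiable_def computes_rank_def
  proof (rule ex1I[of _ A])
    show "computes d A T \<and> non_redundant d A T \<and> card A = form_rank d T"
      using assms(2-4) rank by simp
    show "B = A" if "computes d B T \<and> non_redundant d B T \<and> card B = form_rank d T" for B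
      using that uniq rank by simp
  qed
  ultimately show ?thesis by blast
qed

end
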